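(* Consider the continuous-time networked dynamical system $$\dot{\mathbf{x}}(t)=(I_N\otimes A+\mathbf{G}\otimes bc^T)\mathbf{x}(t)+(I_N\otimes b)\mathbf{w}(t),\qquad \mathbf{y}(t)=(I_N\otimes c^T)\mathbf{x}(t),$$ where $A\in\mathbb{R}^{n\times n}$, $b,c\in\mathbb{R}^n$, the connectivity matrix $\mathbf{G}=[g_{ij}]\in\mathbb{R}^{N\times N}$ has $g_{ij}\ge0$, and $I_N\otimes A+\mathbf{G}\otimes bc^T$ is Hurwitz. Assume the inputs $w_1,\dots,w_N$ are uncorrelated zero-mean wide-sense stationary processes with identical autocorrelation function, hence common power spectral density $S_w(\omega)$, and that $S_w(\omega)>0$ for all $\omega\in(-\Omega,\Omega)$, where $\Omega>0$. Then, for $\omega\in(-\Omega,\Omega)$, the input power spectral density can be computed as $$S_w(\omega)=\frac{\lambda^2|h(\mathrm{j}\omega)|^2-2\lambda\,\mathrm{Re}\{h(\mathrm{j}\omega)\}+1}{(\boldsymbol{u}^T\mathbf{S}^{-1}(\omega)\boldsymbol{u})\,|h(\mathrm{j}\omega)|^2},$$ where $(\lambda,\boldsymbol{u})$ is an eigenvalue-eigenvector pair of $\mathbf{G}$, $h(\mathrm{j}\omega)=c^T(\mathrm{j}\omega I_n-A)^{-1}b$ is the nodal transfer function, and $\mathbf{S}(\omega)=[S_{y_iy_j}(\omega)]$ is the $N\times N$ matrix of output cross-power spectral densities.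
   Context: $\mathrm{j}$ (upright) is the imaginary unit; $\otimes$ is the Kronecker product; $I_d$ is the $d\times d$ identity matrix. $\mathbf{x}(t)\in\mathbb{R}^{Nn}$ is the network state, $\mathbf{w}(t)=(w_1(t),\dots,w_N(t))^T$ the input noise vector, and $\mathbf{y}(t)=(y_1(t),\dots,y_N(t))^T$ the output vector, all real stochastic processes. The cross-correlation is $R_{xy}(\tau)=\mathbb{E}(x(t)y(t-\tau))$, the cross-power spectral density $S_{xy}(\omega)$ is its Fourier transform, and the power spectral density is $S_x=S_{xx}$.
   Formalization: The eigenvector is normalized, u^T u = 1 (the printed right-hand side scales as 1/(u^T u), so it fails otherwise); jωI−A and S(ω) are assumed invertible at the given ω, and the state is in its stationary regime with the derivative taken in mean square. *)

theory Defs
  imports "HOL-Probability.Probability"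
begin

section \<open>Matrices\<close>

abbreviation cmat :: "real^'n^'m \<Rightarrow> complex^'n^'m" where
  "cmat A \<equiv> map_matrix complex_of_real A"

abbreviation cvec :: "real^'n \<Rightarrow> complex^'n" where
  "cvec v \<equiv> (\<chi> i. complex_of_real (v $ i))"

definition eigenpair :: "complex^'n^'n \<Rightarrow> complex \<Rightarrow> complex^'n \<Rightarrow> bool" where
  "eigenpair A l v \<longleftrightarrow> v \<noteq> 0 \<and> A *v v = l *s v"

definition hurwitz :: "real^'n^'n \<Rightarrow> bool" where
  "hurwitz A \<longleftrightarrow> (\<forall>l v. eigenpair (cmat A) l v \<longrightarrow> Re l < 0)"

definition kron :: "real^'j^'i \<Rightarrow> real^'l^'k \<Rightarrow> real^('j \<times> 'l)^('i \<times> 'k)" where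
  "kron A B = (\<chi> p q. A $ fst p $ fst q * B $ snd p $ snd q)"

text \<open>Kronecker products with a column \<open>v\<close> and with a row \<open>v\<close> (transposed vector).
  The trivial index factor of type \<open>1\<close> is dropped, so that
  the product acts on (respectively maps to) vectors indexed by \<open>'j\<close> (respectively \<open>'i\<close>)
  instead of \<open>'j \<times> 1\<close> (respectively \<open>'i \<times> 1\<close>); see the two lemmas below.\<close>

definition kron_col :: "real^'j^'i \<Rightarrow> real^'k \<Rightarrow> real^'j^('i \<times> 'k)" where
  "kron_col A v = (\<chi> p j. A $ fst p $ j * v $ snd p)"

definition kron_row :: "real^'j^'i \<Rightarrow> real^'k \<Rightarrow> real^('j \<times> 'k)^'i" where
  "kron_row A v = (\<chi> i q. A $ i $ fst q * v $ snd q)"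

lemma kron_col_eq: "kron_col A v $ p $ j = kron A (columnvector v :: real^1^'k) $ p $ (j, 1)"
  by (simp add: kron_col_def kron_def columnvector_def)

lemma kron_row_eq: "kron_row A v $ i $ q = kron A (rowvector v :: real^'k^1) $ (i, 1) $ q"
  by (simp add: kron_row_def kron_def rowvector_def)

definition outer :: "real^'m \<Rightarrow> real^'n \<Rightarrow> real^'n^'m" where
  "outer b c = (columnvector b :: real^1^'m) ** (rowvector c :: real^'n^1)"

definition nodal_tf :: "real^'n^'n \<Rightarrow> real^'n \<Rightarrow> real^'n \<Rightarrow> complex \<Rightarrow> complex" where
  "nodal_tf A b c s = scalar_product (cvec c) (matrix_inv (mat s - cmat A) *v cvec b)"


section \<open>Stochastic processes\<close>

abbreviation coord :: "(real \<Rightarrow> 'a \<Rightarrow> real^'k) \<Rightarrow> 'k \<Rightarrow> real \<Rightarrow> 'a \<Rightarrow> real" where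
  "coord X i \<equiv> (\<lambda>t \<xi>. X t \<xi> $ i)"

text \<open>Processes are indexed by all times \<open>t \<in> \<real>\<close>.\<close>

definition wss :: "'a measure \<Rightarrow> (real \<Rightarrow> 'a \<Rightarrow> real) \<Rightarrow> bool" where
  "wss P X \<longleftrightarrow>
     (\<forall>t. X t \<in> borel_measurable P \<and> integrable P (\<lambda>\<xi>. (X t \<xi>)\<^sup>2)) \<and>
     (\<forall>t s. (LINT \<xi>|P. X t \<xi>) = (LINT \<xi>|P. X s \<xi>)) \<and>
     (\<forall>t s \<tau>. (LINT \<xi>|P. X t \<xi> * X (t - \<tau>) \<xi>) = (LINT \<xi>|P. X s \<xi> * X (s - \<tau>) \<xi>))"

definition jointly_wss ::
  "'a measure \<Rightarrow> (real \<Rightarrow> 'a \<Rightarrow> real) \<Rightarrow> (real \<Rightarrow> 'a \<Rightarrow> real) \<Rightarrow> bool" where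
  "jointly_wss P X Y \<longleftrightarrow> wss P X \<and> wss P Y \<and>
     (\<forall>t s \<tau>. (LINT \<xi>|P. X t \<xi> * Y (t - \<tau>) \<xi>) = (LINT \<xi>|P. X s \<xi> * Y (s - \<tau>) \<xi>))"

definition uncorrelated ::
  "'a measure \<Rightarrow> (real \<Rightarrow> 'a \<Rightarrow> real) \<Rightarrow> (real \<Rightarrow> 'a \<Rightarrow> real) \<Rightarrow> bool" where
  "uncorrelated P X Y \<longleftrightarrow>
     (\<forall>t s. (LINT \<xi>|P. X t \<xi> * Y s \<xi>) = (LINT \<xi>|P. X t \<xi>) * (LINT \<xi>|P. Y s \<xi>))"

text \<open>Mean-square derivative, the usual meaning of the dot for second-order processes.\<close>

definition has_ms_derivative ::
  "'a measure \<Rightarrow> (real \<Rightarrow> 'a \<Rightarrow> real^'k) \<Rightarrow> ('a \<Rightarrow> real^'k) \<Rightarrow> real \<Rightarrow> bool" where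
  "has_ms_derivative P X D t \<longleftrightarrow>
     ((\<lambda>h. LINT \<xi>|P. (norm ((X (t + h) \<xi> - X t \<xi>) /\<^sub>R h - D \<xi>))\<^sup>2) \<longlongrightarrow> 0) (at 0)"

text \<open>For jointly wide-sense stationary processes the expectation of \<open>X t * Y (t - \<tau>)\<close> does not
  depend on \<open>t\<close>; it is taken here at \<open>t = 0\<close>.\<close>

definition cross_corr ::
  "'a measure \<Rightarrow> (real \<Rightarrow> 'a \<Rightarrow> real) \<Rightarrow> (real \<Rightarrow> 'a \<Rightarrow> real) \<Rightarrow> real \<Rightarrow> real" where
  "cross_corr P X Y \<tau> = (LINT \<xi>|P. X 0 \<xi> * Y (0 - \<tau>) \<xi>)"

text \<open>The Fourier integral is a Henstock--Kurzweil integral over the line, so it also covers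
  conditionally convergent cases such as the (sinc) correlation of band-limited noise.
  Where it does not converge its value is \<open>0\<close>.\<close>

definition fourier :: "(real \<Rightarrow> real) \<Rightarrow> real \<Rightarrow> complex" where
  "fourier f \<omega> = integral UNIV (\<lambda>\<tau>. complex_of_real (f \<tau>) * exp (- (\<i> * of_real (\<omega> * \<tau>))))"

definition cross_psd ::
  "'a measure \<Rightarrow> (real \<Rightarrow> 'a \<Rightarrow> real) \<Rightarrow> (real \<Rightarrow> 'a \<Rightarrow> real) \<Rightarrow> real \<Rightarrow> complex" where
  "cross_psd P X Y = fourier (cross_corr P X Y)"

abbreviation psd :: "'a measure \<Rightarrow> (real \<Rightarrow> 'a \<Rightarrow> real) \<Rightarrow> real \<Rightarrow> complex" where
  "psd P X \<equiv> cross_psd P X X"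

definition cross_psd_matrix ::
  "'a measure \<Rightarrow> (real \<Rightarrow> 'a \<Rightarrow> real^'k) \<Rightarrow> real \<Rightarrow> complex^'k^'k" where
  "cross_psd_matrix P Y \<omega> = (\<chi> i j. cross_psd P (coord Y i) (coord Y j) \<omega>)"

end

(* Let R(t) = E[x(t) x(0)^T] and Q(t) = E[w(0) x(-t)^T], write M for the state matrix and
   B for the input matrix (I_N kron b), and let r be the common autocorrelation of the inputs.
   Mean-square differentiation of the state equation gives R' = M R + B Q and Q' = -Q M^T - r B^T.
   The Fourier integral of r need only converge conditionally, so one has to show that those of
   Q and R converge as well: a bounded solution v of v' = N v + f, where N has no imaginary
   eigenvalue and f has a convergent integral over the line, tends to 0 at both ends, hence
   N (integral of v) + (integral of f) = 0.  For the Fourier transforms this reads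
   S = h (W + G S) and W = h^* (S_w I + W G^T) with h = h(j omega) and W the Fourier transform of
   E[w(0) y(-t)^T].  So (I - h G) S (I - h^* G^T) = |h|^2 S_w I, and both outer factors act as
   scalars in u^T S^-1 u. *)

theory Submission
  imports Defs "HOL-Computational_Algebra.Fundamental_Theorem_Algebra"
begin

section \<open>Asymptotics of linear systems\<close>

text \<open>The correlation \<open>r\<close> is assumed neither continuous nor absolutely
  integrable, and \<open>fourier\<close> has value 0 where its integral diverges. Convergence is
  therefore extracted from the positivity of \<open>S_w\<close> at the frequency in question, and it
  then has to be carried through the differential equations by limits of primitives. The equation
  for Q is antistable in forward time, since its matrix is minus a Hurwitz matrix. This is why the
  asymptotic lemmas ask only for nonzero real parts and rely on boundedness of the solution, which
  stationarity supplies on the whole line, instead of on stability. All pairings with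
  \<open>u\<close> are bilinear, so a complex eigenpair of \<open>cmat G\<close> produces
  \<open>l\<^sup>2\<close> and not a squared modulus. A right eigenvector of G is a left eigenvector
  of its transpose; hence the same \<open>u\<close> serves both outer factors.\<close>

lemma scalar_lti_tendsto_0:
  fixes z g :: "real \<Rightarrow> complex"
  assumes z': "\<And>t. (z has_vector_derivative l * z t + g t) (at t)"
    and l: "Re l \<noteq> 0"
    and bdd: "Bfun z at_top"
    and g: "(g \<longlongrightarrow> 0) at_top"
  shows "(z \<longlongrightarrow> 0) at_top"
proof -
  define \<alpha> where "\<alpha> = Re l"
  have \<alpha>: "\<alpha> \<noteq> 0" using l by (simp add: \<alpha>_def)
  define \<phi> where "\<phi> t = exp (- (of_real t * l)) * z t" for t :: real
  have norm_\<phi>: "norm (\<phi> t) = exp (- \<alpha> * t) * norm (z t)" for t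
    by (simp add: \<phi>_def norm_mult \<alpha>_def mult.commute)
  have \<phi>': "(\<phi> has_vector_derivative exp (- (of_real t * l)) * g t) (at t)" for t
  proof -
    have e: "((\<lambda>t. exp (- (of_real t * l))) has_vector_derivative - l * exp (- (of_real t * l))) (at t)"
      by (rule has_vector_derivative_real_field[of "\<lambda>z. exp (- (z * l))"])
         (auto intro!: derivative_eq_intros)
    show ?thesis unfolding \<phi>_def
      by (rule has_vector_derivative_eq_rhs[OF has_vector_derivative_mult[OF e z']])
         (simp add: algebra_simps)
  qed
  \<comment> \<open>Where the forcing is at most \<epsilon>, comparison with
    \<open>- (\<epsilon> / \<alpha>) * exp (- \<alpha> * t)\<close> bounds the increment of \<phi>.
    Both directions are kept: a growing mode is estimated at \<open>a\<close> from \<open>b\<close>,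
    a decaying one at \<open>b\<close> from \<open>a\<close>.\<close>
  have est: "exp (- \<alpha> * b) * norm (z b) \<le> exp (- \<alpha> * a) * norm (z a)
        + (\<epsilon> / \<alpha>) * (exp (- \<alpha> * a) - exp (- \<alpha> * b)) \<and>
      exp (- \<alpha> * a) * norm (z a) \<le> exp (- \<alpha> * b) * norm (z b)
        + (\<epsilon> / \<alpha>) * (exp (- \<alpha> * a) - exp (- \<alpha> * b))"
    if "a < b" and gle: "\<And>t. t \<ge> a \<Longrightarrow> norm (g t) \<le> \<epsilon>" for a b \<epsilon> :: real
  proof -
    have "norm (\<phi> b - \<phi> a) \<le> - (\<epsilon> / \<alpha>) * exp (- \<alpha> * b) - - (\<epsilon> / \<alpha>) * exp (- \<alpha> * a)"
    proof (rule differentiable_bound_general[OF \<open>a < b\<close>])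
      show "continuous_on {a..b} \<phi>"
        using \<phi>' by (meson continuous_at_imp_continuous_on has_vector_derivative_continuous)
      show "continuous_on {a..b} (\<lambda>t. - (\<epsilon> / \<alpha>) * exp (- \<alpha> * t))"
        by (intro continuous_intros)
      show "(\<phi> has_vector_derivative exp (- (of_real t * l)) * g t) (at t)" for t
        by (rule \<phi>')
      show "((\<lambda>t. - (\<epsilon> / \<alpha>) * exp (- \<alpha> * t)) has_vector_derivative \<epsilon> * exp (- \<alpha> * t)) (at t)" for t
        using \<alpha> by (auto intro!: derivative_eq_intros
            simp flip: has_real_derivative_iff_has_vector_derivative)
      show "norm (exp (- (of_real t * l)) * g t) \<le> \<epsilon> * exp (- \<alpha> * t)" if "a < t" for t
        using gle[of t] that by (simp add: norm_mult \<alpha>_def mult.commute)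
    qed
    moreover have "norm (\<phi> b) \<le> norm (\<phi> a) + norm (\<phi> b - \<phi> a)"
      "norm (\<phi> a) \<le> norm (\<phi> b) + norm (\<phi> b - \<phi> a)"
      by (metis norm_triangle_sub add.commute)
         (metis norm_triangle_sub add.commute norm_minus_commute)
    ultimately show ?thesis by (simp add: norm_\<phi> algebra_simps)
  qed
  obtain K where K: "eventually (\<lambda>t. norm (z t) \<le> K) at_top" "K > 0"
    using bdd by (auto simp: Bfun_def)
  show ?thesis
  proof (rule tendstoI)
    fix e :: real assume "e > 0"
    define \<epsilon> where "\<epsilon> = e * \<bar>\<alpha>\<bar> / 3"
    have "\<epsilon> > 0" using \<open>e > 0\<close> \<alpha> by (simp add: \<epsilon>_def)
    then have "eventually (\<lambda>t. norm (g t) < \<epsilon>) at_top"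
      using tendstoD[OF g] by simp
    from eventually_conj[OF this K(1)] obtain T
      where T: "\<And>t. t \<ge> T \<Longrightarrow> norm (g t) < \<epsilon> \<and> norm (z t) \<le> K"
      by (auto simp: eventually_at_top_linorder)
    then have gle: "\<And>t. t \<ge> T \<Longrightarrow> norm (g t) \<le> \<epsilon>" by force
    show "eventually (\<lambda>t. dist (z t) 0 < e) at_top"
    proof (cases "\<alpha> > 0")
      case True
      \<comment> \<open>A growing mode stays bounded only if it is small already: as
        \<open>b\<close> tends to infinity, the contribution of \<open>z b\<close> is damped away by
        the exponential.\<close>
      have "norm (z a) \<le> \<epsilon> / \<alpha>" if "a \<ge> T" for a
      proof -
        have "eventually (\<lambda>b. exp (- \<alpha> * a) * norm (z a) \<le> exp (- \<alpha> * b) * K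
                + (\<epsilon> / \<alpha>) * exp (- \<alpha> * a)) at_top"
          using eventually_gt_at_top[of a]
        proof eventually_elim
          case (elim b)
          have "exp (- \<alpha> * b) * norm (z b) \<le> exp (- \<alpha> * b) * K"
            using T[of b] elim that by simp
          moreover have "(\<epsilon> / \<alpha>) * exp (- \<alpha> * b) \<ge> 0" using True \<open>\<epsilon> > 0\<close> by simp
          ultimately show ?case
            using conjunct2[OF est[OF elim gle[OF order_trans[OF that]]]]
            unfolding right_diff_distrib by linarith
        qed
        moreover have "((\<lambda>b. exp (- \<alpha> * b) * K + (\<epsilon> / \<alpha>) * exp (- \<alpha> * a)) \<longlongrightarrow>
            0 * K + (\<epsilon> / \<alpha>) * exp (- \<alpha> * a)) at_top"
          using True by (intro tendsto_intros) real_asymp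
        ultimately have "exp (- \<alpha> * a) * norm (z a) \<le> 0 * K + (\<epsilon> / \<alpha>) * exp (- \<alpha> * a)"
          by (intro tendsto_lowerbound[where F = at_top]) auto
        then have "norm (z a) * exp (- \<alpha> * a) \<le> \<epsilon> / \<alpha> * exp (- \<alpha> * a)"
          by (simp add: mult.commute)
        then show ?thesis by (rule mult_right_le_imp_le) simp
      qed
      moreover have "\<epsilon> / \<alpha> < e" using True \<open>e > 0\<close> by (simp add: \<epsilon>_def)
      ultimately show ?thesis
        by (auto simp: eventually_at_top_linorder intro!: exI[of _ T] intro: le_less_trans)
    next
      case False
      then have neg: "\<alpha> < 0" using \<alpha> by simp
      have "norm (z b) \<le> exp (\<alpha> * (b - T)) * K + \<epsilon> / \<bar>\<alpha>\<bar>" if "b > T" for b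
      proof -
        have "exp (- \<alpha> * b) * norm (z b) \<le> exp (- \<alpha> * T) * norm (z T)
            + (\<epsilon> / \<bar>\<alpha>\<bar>) * (exp (- \<alpha> * b) - exp (- \<alpha> * T))"
          using conjunct1[OF est[OF that gle]] neg by (simp add: right_diff_distrib)
        also have "\<dots> \<le> exp (- \<alpha> * T) * K + (\<epsilon> / \<bar>\<alpha>\<bar>) * exp (- \<alpha> * b)"
        proof -
          have "exp (- \<alpha> * T) * norm (z T) \<le> exp (- \<alpha> * T) * K" using T[of T] by simp
          moreover have "(\<epsilon> / \<bar>\<alpha>\<bar>) * exp (- \<alpha> * T) \<ge> 0" using \<open>\<epsilon> > 0\<close> by simp
          ultimately show ?thesis unfolding right_diff_distrib by linarith
        qed
        finally have "exp (\<alpha> * b) * (exp (- \<alpha> * b) * norm (z b))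
            \<le> exp (\<alpha> * b) * (exp (- \<alpha> * T) * K + (\<epsilon> / \<bar>\<alpha>\<bar>) * exp (- \<alpha> * b))"
          by (rule mult_left_mono) simp
        then show ?thesis
          by (simp add: exp_minus exp_diff right_diff_distrib field_simps)
      qed
      then have 1: "eventually (\<lambda>b. norm (z b) \<le> exp (\<alpha> * (b - T)) * K + \<epsilon> / \<bar>\<alpha>\<bar>) at_top"
        by (rule eventually_mono[OF eventually_gt_at_top])
      have "((\<lambda>b. exp (\<alpha> * (b - T)) * K + \<epsilon> / \<bar>\<alpha>\<bar>) \<longlongrightarrow> 0 * K + \<epsilon> / \<bar>\<alpha>\<bar>) at_top"
        using neg by (intro tendsto_intros) real_asymp
      moreover have "0 * K + \<epsilon> / \<bar>\<alpha>\<bar> < e" using neg \<open>e > 0\<close> by (simp add: \<epsilon>_def)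
      ultimately have "eventually (\<lambda>b. exp (\<alpha> * (b - T)) * K + \<epsilon> / \<bar>\<alpha>\<bar> < e) at_top"
        by (rule order_tendstoD(2))
      with 1 show ?thesis by eventually_elim simp
    qed
  qed
qed

section \<open>Polynomials in a matrix\<close>

definition matrix_poly :: "'a::comm_ring_1^'n^'n \<Rightarrow> 'a poly \<Rightarrow> 'a^'n^'n" where
  "matrix_poly N p = fold_coeffs (\<lambda>a X. mat a + N ** X) p 0"

lemma matrix_poly_0 [simp]: "matrix_poly N 0 = 0"
  by (simp add: matrix_poly_def)

lemma mat_0 [simp]: "mat 0 = (0 :: 'a::semiring_1^'n^'n)"
  by (simp add: vec_eq_iff mat_def)

lemma mat_add: "mat (a + b) = (mat a + mat b :: 'a::semiring_1^'n^'n)"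
  by (simp add: vec_eq_iff mat_def)

lemma matrix_mul_0 [simp]: "(A :: 'a::semiring_1^'n^'m) ** 0 = (0 :: 'a^'k^'m)"
  by (simp add: vec_eq_iff matrix_matrix_mult_def)

lemma matrix_add_rdistrib: "(A + B) ** C = A ** C + B ** (C :: 'a::semiring_1^'k^'n)"
  by (simp add: vec_eq_iff matrix_matrix_mult_def sum.distrib distrib_right)

lemma mat_mul_eq: "mat c ** X = (\<chi> i j. c * X $ i $ j)" for X :: "'a::semiring_1^'n^'m"
  by (simp add: matrix_matrix_mult_def mat_def if_distrib[where f = "\<lambda>x. x * _"] sum.delta cong: if_cong)

lemma mat_mul_commute: "X ** mat c = mat c ** (X :: 'a::comm_semiring_1^'n^'m)"
  by (simp add: mat_mul_eq vec_eq_iff)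
     (simp add: matrix_matrix_mult_def mat_def if_distrib[where f = "\<lambda>x. _ * x"] sum.delta' mult.commute cong: if_cong)

lemma mat_vec_eq: "mat c *v v = c *s (v :: 'a::semiring_1^'n)"
  by (simp add: vec_eq_iff matrix_vector_mult_def mat_def if_distrib[where f = "\<lambda>x. x * _"] sum.delta cong: if_cong)

lemma matrix_poly_pCons [simp]: "matrix_poly N (pCons a p) = mat a + N ** matrix_poly N p"
  by (cases "p = 0 \<and> a = 0") (auto simp: matrix_poly_def)

lemma matrix_poly_add: "matrix_poly N (p + q) = matrix_poly N p + matrix_poly N q"
  by (induction p q rule: poly_induct2) (simp_all add: mat_add matrix_add_ldistrib algebra_simps)

lemma matrix_poly_smult: "matrix_poly N (smult c p) = mat c ** matrix_poly N p"
proof (induction p)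
  case (pCons a p)
  have "mat (c * a) = mat c ** (mat a :: 'a^'n^'n)"
    by (simp add: mat_mul_eq vec_eq_iff) (simp add: mat_def)
  moreover have "N ** (mat c ** matrix_poly N p) = mat c ** (N ** matrix_poly N p)"
    by (metis mat_mul_commute matrix_mul_assoc)
  ultimately show ?case using pCons by (simp add: matrix_add_ldistrib)
qed simp

text \<open>The instance of multiplicativity that the removal of roots relies on: a linear factor
  comes off on the left.\<close>

lemma matrix_poly_linear_mult:
  "matrix_poly N ([:-l, 1:] * p) = (N - mat l) ** matrix_poly N p"
proof -
  have "[:-l, 1:] * p = smult (-l) p + pCons 0 p" by simp
  then have "matrix_poly N ([:-l, 1:] * p) = mat (-l) ** matrix_poly N p + N ** matrix_poly N p"
    by (simp only: matrix_poly_add matrix_poly_smult matrix_poly_pCons) simp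
  also have "\<dots> = (mat (-l) + N) ** matrix_poly N p"
    by (simp add: matrix_add_rdistrib)
  also have "mat (-l) + N = N - mat l"
    by (simp add: vec_eq_iff mat_def)
  finally show ?thesis .
qed

text \<open>Makes \<open>matrix_poly N q *v v t\<close> obey the same linear equation as
  \<open>v\<close>, with the forcing transformed in the same way.\<close>

lemma matrix_poly_commute: "matrix_poly N p ** N = N ** matrix_poly N p"
proof (induction p)
  case 0
  show ?case by (simp add: matrix_matrix_mult_def vec_eq_iff)
next
  case (pCons a p)
  then show ?case
    by (simp add: matrix_add_ldistrib matrix_add_rdistrib mat_mul_commute flip: matrix_mul_assoc)
qed

lemma matrix_poly_sum: "matrix_poly N (sum f I) = (\<Sum>i\<in>I. matrix_poly N (f i))"
  by (induction I rule: infinite_finite_induct) (simp_all add: matrix_poly_add)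

text \<open>The powers of \<open>N\<close> lie in a finite-dimensional real space, so they are
  linearly dependent.\<close>

lemma matrix_poly_annihilator:
  fixes N :: "complex^'n^'n"
  obtains p where "p \<noteq> 0" "matrix_poly N p = 0"
proof -
  have "\<exists>p. p \<noteq> 0 \<and> matrix_poly N p = 0"
  proof (rule ccontr)
    assume contr: "\<not> ?thesis"
    then have nz: "p = 0" if "matrix_poly N p = 0" for p using that by blast
    define f where "f i = matrix_poly N (monom 1 i)" for i :: nat
    \<comment> \<open>\<open>dependent\<close> speaks of sets. Injectivity makes the first
      \<open>n + 1\<close> powers that many distinct vectors and later allows the sum over the image
      to be reindexed.\<close>
    have "inj f"
    proof (rule injI)
      fix i j assume eq: "f i = f j"
      have "matrix_poly N (monom 1 i + smult (-1) (monom 1 j)) = f i + mat (-1) ** f j"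
        by (simp only: matrix_poly_add matrix_poly_smult f_def)
      also have "\<dots> = 0" by (simp add: eq mat_mul_eq vec_eq_iff)
      finally have "monom 1 i = (monom 1 j :: complex poly)" using nz by fastforce
      then show "i = j" by (simp add: monom_eq_iff')
    qed
    \<comment> \<open>This is the real dimension, because \<open>dependent\<close> has real
      coefficients; hence the \<open>complex_of_real\<close> in \<open>p\<close>.\<close>
    define n where "n = DIM(complex^'n^'n)"
    have "dependent (f ` {..n})"
      by (rule dependent_biggerset)
         (simp add: card_image inj_on_subset[OF \<open>inj f\<close>] n_def)
    then obtain c i where c: "(\<Sum>v\<in>f ` {..n}. c v *\<^sub>R v) = 0" "i \<le> n" "c (f i) \<noteq> 0"
      by (auto simp: dependent_finite)
    define p where "p = (\<Sum>j\<le>n. monom (complex_of_real (c (f j))) j)"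
    have "matrix_poly N p = (\<Sum>j\<le>n. c (f j) *\<^sub>R f j)"
      unfolding p_def matrix_poly_sum
    proof (rule sum.cong[OF refl])
      fix j
      have "matrix_poly N (monom (complex_of_real (c (f j))) j)
          = matrix_poly N (smult (complex_of_real (c (f j))) (monom 1 j))"
        by (simp add: smult_monom)
      also have "\<dots> = c (f j) *\<^sub>R f j"
        unfolding matrix_poly_smult
        by (simp only: flip: f_def)
           (simp add: mat_mul_eq vec_eq_iff, simp add: scaleR_conv_of_real)
      finally show "matrix_poly N (monom (complex_of_real (c (f j))) j) = c (f j) *\<^sub>R f j" .
    qed
    also have "\<dots> = 0"
      using c(1) by (subst (asm) sum.reindex) (auto intro: inj_on_subset[OF \<open>inj f\<close>])
    finally have "p = 0" by (rule nz)
    moreover have "coeff p i = complex_of_real (c (f i))"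
      using c(2) by (simp add: p_def coeff_sum)
    ultimately show False using c(3) by simp
  qed
  then show thesis using that by blast
qed

lemma Bfun_matrix_vector_mult:
  fixes v :: "'a \<Rightarrow> complex^'n" and A :: "complex^'n^'m"
  assumes "Bfun v F"
  shows "Bfun (\<lambda>t. A *v v t) F"
proof -
  obtain K where K: "eventually (\<lambda>t. norm (v t) \<le> K) F" using assms by (auto simp: Bfun_def)
  obtain B where B: "\<And>x. norm (A *v x) \<le> norm x * B"
    using bounded_linear.bounded[OF matrix_vector_mul_bounded_linear] by blast
  show ?thesis
  proof (rule BfunI)
    show "eventually (\<lambda>t. norm (A *v v t) \<le> K * \<bar>B\<bar>) F"
      using K
    proof eventually_elim
      case (elim t)
      have "norm (A *v v t) \<le> norm (v t) * \<bar>B\<bar>"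
        using B[of "v t"] by (smt (verit) abs_ge_self mult_left_mono norm_ge_zero)
      also have "\<dots> \<le> K * \<bar>B\<bar>" using elim by (intro mult_right_mono) auto
      finally show ?case .
    qed
  qed
qed

lemma tendsto_matrix_vector_mult_0:
  fixes v :: "'a \<Rightarrow> complex^'n" and A :: "complex^'n^'m"
  assumes "(v \<longlongrightarrow> 0) F"
  shows "((\<lambda>t. A *v v t) \<longlongrightarrow> 0) F"
  using bounded_linear.tendsto[OF matrix_vector_mul_bounded_linear assms, of A] by simp

lemma not_eigenvalue_invertible:
  fixes N :: "complex^'n^'n"
  assumes "\<nexists>v. eigenpair N l v"
  obtains B where "B ** (N - mat l) = mat 1"
proof -
  have "x = 0" if "(N - mat l) *v x = 0" for x
    using assms that by (auto simp: eigenpair_def mat_vec_eq matrix_vector_mult_diff_rdistrib)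
  then show thesis using that matrix_left_invertible_ker[of "N - mat l"] by blast
qed

text \<open>Repeated roots of the annihilating polynomial are removed in separate steps, each
  leaving a forcing that vanishes at infinity, so a non-diagonalizable \<open>N\<close> is covered
  too.\<close>

lemma lti_tendsto_0:
  fixes v f :: "real \<Rightarrow> complex^'n"
  assumes v': "\<And>t. (v has_vector_derivative N *v v t + f t) (at t)"
    and N: "\<And>l u. eigenpair N l u \<Longrightarrow> Re l \<noteq> 0"
    and bdd: "Bfun v at_top"
    and f: "(f \<longlongrightarrow> 0) at_top"
  shows "(v \<longlongrightarrow> 0) at_top"
proof -
  obtain p where p: "p \<noteq> 0" "matrix_poly N p = 0"
    using matrix_poly_annihilator .
  \<comment> \<open>The factors of \<open>p\<close> are stripped off one by one: an eigenvalue leaves scalar equations,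
    and any other factor is an invertible matrix.\<close>
  obtain L where L: "p = smult (lead_coeff p) (\<Prod>x\<in>#L. [:-x, 1:])"
    using alg_closed_imp_factorization[OF p(1)] by blast
  have *: "(v \<longlongrightarrow> 0) at_top"
    if "((\<lambda>t. matrix_poly N (\<Prod>x\<in>#L. [:-x, 1:]) *v v t) \<longlongrightarrow> 0) at_top" for L
    using that
  proof (induction L)
    case empty
    then show ?case by (simp add: one_pCons)
  next
    case (add l L)
    define q where "q = (\<Prod>x\<in>#L. [:-x, 1:])"
    define z where "z t = matrix_poly N q *v v t" for t
    have "((\<lambda>t. (N - mat l) *v z t) \<longlongrightarrow> 0) at_top"
      using add.prems
      by (simp only: image_mset_add_mset prod_mset.add_mset matrix_poly_linear_mult
          flip: q_def matrix_vector_mul_assoc z_def)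
    then have lim: "((\<lambda>t. N *v z t - l *s z t) \<longlongrightarrow> 0) at_top"
      by (simp add: matrix_vector_mult_diff_rdistrib mat_vec_eq)
    have "(z \<longlongrightarrow> 0) at_top"
    proof (cases "\<exists>u. eigenpair N l u")
      case True
      then have l: "Re l \<noteq> 0" using N by blast
      \<comment> \<open>Up to a vanishing term \<open>N *v z t\<close> equals
        \<open>l *s z t\<close>, so every coordinate obeys a scalar equation with rate
        \<open>l\<close>.\<close>
      have "((\<lambda>t. z t $ i) \<longlongrightarrow> 0) at_top" for i
      proof (rule scalar_lti_tendsto_0[OF _ l])
        fix t
        have "(z has_vector_derivative matrix_poly N q *v (N *v v t + f t)) (at t)"
          unfolding z_def
          by (rule bounded_linear.has_vector_derivative[OF matrix_vector_mul_bounded_linear v'])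
        also have "matrix_poly N q *v (N *v v t + f t) = N *v z t + matrix_poly N q *v f t"
          by (simp add: z_def matrix_vector_right_distrib matrix_vector_mul_assoc matrix_poly_commute)
        finally show "((\<lambda>t. z t $ i) has_vector_derivative
            l * z t $ i + ((N *v z t - l *s z t) + matrix_poly N q *v f t) $ i) (at t)"
          by (auto dest: bounded_linear.has_vector_derivative[OF bounded_linear_vec_nth])
      next
        have "Bfun z at_top"
          unfolding z_def by (rule Bfun_matrix_vector_mult[OF bdd])
        then obtain C where "eventually (\<lambda>t. norm (z t) \<le> C) at_top" by (auto simp: Bfun_def)
        then show "Bfun (\<lambda>t. z t $ i) at_top"
          by (intro BfunI[of _ C]) (auto elim!: eventually_mono intro: order_trans[OF Finite_Cartesian_Product.norm_nth_le])
        have "((\<lambda>t. (N *v z t - l *s z t) + matrix_poly N q *v f t) \<longlongrightarrow> 0 + 0) at_top"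
          by (intro tendsto_add lim tendsto_matrix_vector_mult_0 f)
        then show "((\<lambda>t. ((N *v z t - l *s z t) + matrix_poly N q *v f t) $ i) \<longlongrightarrow> 0) at_top"
          by (auto dest: tendsto_vec_nth)
      qed
      then show ?thesis by (auto intro!: vec_tendstoI)
    next
      case False
      then obtain B where B: "B ** (N - mat l) = mat 1" by (rule not_eigenvalue_invertible)
      have "B *v (N *v z t - l *s z t) = z t" for t
        using B by (metis matrix_vector_mul_assoc matrix_vector_mul_lid
            matrix_vector_mult_diff_rdistrib mat_vec_eq)
      then show ?thesis
        using tendsto_matrix_vector_mult_0[OF lim, of B] by simp
    qed
    then show ?case by (intro add.IH) (simp add: z_def[abs_def] q_def)
  qed
  have "mat (lead_coeff p) ** matrix_poly N (\<Prod>x\<in>#L. [:-x, 1:]) = 0"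
    using p(2) L by (metis matrix_poly_smult)
  then have "matrix_poly N (\<Prod>x\<in>#L. [:-x, 1:]) = 0"
    using p(1) by (simp add: mat_mul_eq vec_eq_iff)
  then show ?thesis by (intro *[of L]) simp
qed

text \<open>A convergent primitive is what a conditionally convergent integral of the forcing offers
  at one end of the line.\<close>

lemma lti_lim_primitive:
  fixes v F :: "real \<Rightarrow> complex^'n"
  assumes v': "\<And>t. (v has_vector_derivative N *v v t + f t) (at t)"
    and N: "\<And>l u. eigenpair N l u \<Longrightarrow> Re l \<noteq> 0"
    and bdd: "\<And>t. norm (v t) \<le> K"
    and F': "\<And>t. (F has_vector_derivative f t) (at t)"
    and F: "(F \<longlongrightarrow> F0) at_top"
  shows "(v \<longlongrightarrow> 0) at_top"
proof -
  \<comment> \<open>Here \<open>f\<close> itself need not tend to \<open>0\<close>; subtracting \<open>F - F0\<close> replaces it by a forcing that does.\<close>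
  define g where "g t = v t - (F t - F0)" for t
  have g_lim: "((\<lambda>t. F t - F0) \<longlongrightarrow> 0) at_top"
    using F by (simp add: LIM_zero_iff)
  have "(g \<longlongrightarrow> 0) at_top"
  proof (rule lti_tendsto_0[OF _ N])
    fix t
    have "(g has_vector_derivative (N *v v t + f t) - (f t - 0)) (at t)"
      unfolding g_def
      by (intro has_vector_derivative_diff v' F' has_vector_derivative_const)
    then show "(g has_vector_derivative N *v g t + N *v (F t - F0)) (at t)"
      by (simp add: g_def matrix_vector_mult_diff_distrib)
  next
    have "eventually (\<lambda>t. dist (F t - F0) 0 < 1) at_top" using g_lim by (rule tendstoD) simp
    then show "Bfun g at_top"
      by (intro BfunI[of _ "K + 1"])
         (auto simp: g_def elim!: eventually_mono intro!: order_trans[OF norm_triangle_ineq4[of "v _"]]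
            add_mono bdd)
    show "((\<lambda>t. N *v (F t - F0)) \<longlongrightarrow> 0) at_top"
      using g_lim by (rule tendsto_matrix_vector_mult_0)
  qed
  from tendsto_add[OF this g_lim] show ?thesis by (simp add: g_def)
qed

lemma eigenpair_uminus: "eigenpair (- N) l u \<longleftrightarrow> eigenpair N (- l) u"
  by (auto simp: eigenpair_def vec_eq_iff matrix_vector_mult_def sum_negf minus_equation_iff)

section \<open>Integrals over the line of bounded solutions\<close>

text \<open>The points at distance \<open>B / 2\<close> lie in the open ball, which avoids a closure
  argument at its boundary; the lost factor 2 is absorbed when the radius is chosen.\<close>

lemma ball_subset_cbox_real:
  fixes a b B :: real
  assumes "ball 0 B \<subseteq> cbox a b" "B > 0"
  shows "a \<le> - (B / 2)" "B / 2 \<le> b"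
proof -
  have "- (B / 2) \<in> ball 0 B" "B / 2 \<in> ball 0 B" using assms(2) by auto
  then have "- (B / 2) \<in> cbox a b" "B / 2 \<in> cbox a b" using assms(1) by blast+
  then show "a \<le> - (B / 2)" "B / 2 \<le> b" by auto
qed

text \<open>The Henstock-Kurzweil integral inverts every derivative on compact intervals, and over
  the line it is a limit along growing intervals. Limits of the primitive at both ends therefore
  suffice, without absolute integrability.\<close>

lemma has_integral_UNIV_primitive:
  fixes F :: "real \<Rightarrow> 'a::banach"
  assumes F': "\<And>t. (F has_vector_derivative f t) (at t)"
    and top: "(F \<longlongrightarrow> U) at_top" and bot: "(F \<longlongrightarrow> L) at_bot"
  shows "(f has_integral (U - L)) UNIV"
proof -
  have "\<exists>B>0. \<forall>a b. ball 0 B \<subseteq> cbox a b \<longrightarrow>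
      (\<exists>z. (f has_integral z) (cbox a b) \<and> norm (z - (U - L)) < e)" if "e > 0" for e :: real
  proof -
    obtain T where T: "\<And>t. t \<ge> T \<Longrightarrow> dist (F t) U < e / 2"
      using tendstoD[OF top, of "e / 2"] \<open>e > 0\<close> by (auto simp: eventually_at_top_linorder)
    obtain S where S: "\<And>t. t \<le> S \<Longrightarrow> dist (F t) L < e / 2"
      using tendstoD[OF bot, of "e / 2"] \<open>e > 0\<close> by (auto simp: eventually_at_bot_linorder)
    define B where "B = 2 * max 1 (max \<bar>T\<bar> \<bar>S\<bar>)"
    have "B > 0" by (simp add: B_def)
    moreover have "\<exists>z. (f has_integral z) (cbox a b) \<and> norm (z - (U - L)) < e"
      if "ball 0 B \<subseteq> cbox a b" for a b
    proof -
      note ab = ball_subset_cbox_real[OF that \<open>B > 0\<close>]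
      have "T \<le> b" "a \<le> S" using ab unfolding B_def by linarith+
      have "(f has_integral (F b - F a)) (cbox a b)"
        unfolding cbox_interval using ab \<open>B > 0\<close>
        by (intro fundamental_theorem_of_calculus) (auto intro: has_vector_derivative_at_within[OF F'])
      moreover have "dist (F b) U < e / 2" "dist (F a) L < e / 2"
        using T[OF \<open>T \<le> b\<close>] S[OF \<open>a \<le> S\<close>] by simp_all
      then have "norm ((F b - U) - (F a - L)) < e"
        using norm_triangle_ineq4[of "F b - U" "F a - L"] by (simp add: dist_norm)
      then have "norm ((F b - F a) - (U - L)) < e" by (simp add: algebra_simps)
      ultimately show ?thesis by blast
    qed
    ultimately show ?thesis by blast
  qed
  moreover have "\<not> (\<exists>a b. (UNIV :: real set) = cbox a b)"
    using not_compact_UNIV compact_cbox by metis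
  ultimately show ?thesis by (subst has_integral_alt) (simp only: if_False if_True UNIV_I, blast)
qed

text \<open>Integrability over the line makes \<open>F b - F a\<close> close to \<open>I\<close> for
  all large intervals at once; freezing one endpoint turns this into a Cauchy condition at the
  other.\<close>

lemma has_integral_UNIV_primitiveE:
  fixes F :: "real \<Rightarrow> 'a::banach"
  assumes F': "\<And>t. (F has_vector_derivative f t) (at t)"
    and f: "(f has_integral I) UNIV"
  obtains U L where "(F \<longlongrightarrow> U) at_top" "(F \<longlongrightarrow> L) at_bot" "U - L = I"
proof -
  have unb: "\<not> (\<exists>a b. (UNIV :: real set) = cbox a b)"
    using not_compact_UNIV compact_cbox by metis
  have *: "\<exists>B>0. \<forall>a b. a \<le> - B \<and> B \<le> b \<longrightarrow> norm (F b - F a - I) < e" if "e > 0" for e :: real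
  proof -
    obtain B where B: "B > 0" and Bz: "\<And>a b. ball 0 B \<subseteq> cbox a b \<Longrightarrow>
        \<exists>z. (f has_integral z) (cbox a b) \<and> norm (z - I) < e"
      using has_integral_altD[OF f unb \<open>e > 0\<close>] by auto
    have "norm (F b - F a - I) < e" if "a \<le> - B" "B \<le> b" for a b
    proof -
      have "ball 0 B \<subseteq> cbox a b" using that by (auto simp: dist_real_def)
      then obtain z where z: "(f has_integral z) (cbox a b)" "norm (z - I) < e" using Bz by blast
      have "(f has_integral (F b - F a)) (cbox a b)"
        unfolding cbox_interval using that B
        by (intro fundamental_theorem_of_calculus) (auto intro: has_vector_derivative_at_within[OF F'])
      then show ?thesis using z has_integral_unique by blast
    qed
    then show ?thesis using B by blast
  qed
  have "Cauchy (\<lambda>n. F (real n))"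
  proof (rule metric_CauchyI)
    fix e :: real assume "e > 0"
    then obtain B where B: "B > 0" "\<And>a b. a \<le> - B \<Longrightarrow> B \<le> b \<Longrightarrow> norm (F b - F a - I) < e / 2"
      using *[of "e / 2"] by auto
    have "dist (F (real m)) (F (real n)) < e" if "m \<ge> nat \<lceil>B\<rceil>" "n \<ge> nat \<lceil>B\<rceil>" for m n
    proof -
      have "B \<le> real m" "B \<le> real n" using that by linarith+
      then have "norm (F (real m) - F (- B) - I) < e / 2" "norm (F (real n) - F (- B) - I) < e / 2"
        using B by auto
      then show ?thesis using norm_triangle_ineq4[of "F (real m) - F (- B) - I" "F (real n) - F (- B) - I"]
        by (simp add: dist_norm)
    qed
    then show "\<exists>M. \<forall>m\<ge>M. \<forall>n\<ge>M. dist (F (real m)) (F (real n)) < e" by blast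
  qed
  then obtain U where U: "(\<lambda>n. F (real n)) \<longlonglongrightarrow> U"
    by (meson Cauchy_convergent convergent_def)
  have bot': "\<exists>B>0. \<forall>a \<le> - B. norm (F a - (U - I)) \<le> e" if e: "e > 0" for e :: real
  proof -
    obtain B where B: "B > 0" "\<And>a b. a \<le> - B \<Longrightarrow> B \<le> b \<Longrightarrow> norm (F b - F a - I) < e"
      using *[OF e] by auto
    have "norm (F a - (U - I)) \<le> e" if "a \<le> - B" for a
    proof -
      have "(\<lambda>n. norm (F (real n) - F a - I)) \<longlonglongrightarrow> norm (U - F a - I)"
        by (intro tendsto_intros U)
      moreover have "eventually (\<lambda>n. norm (F (real n) - F a - I) \<le> e) sequentially"
        using eventually_ge_at_top[of "nat \<lceil>B\<rceil>"]
      proof eventually_elim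
        case (elim n)
        then have "B \<le> real n" by linarith
        then show ?case using B(2)[OF that] by (simp add: less_imp_le)
      qed
      ultimately have "norm (U - F a - I) \<le> e"
        by (rule tendsto_upperbound) simp
      moreover have "U - F a - I = - (F a - (U - I))" by simp
      ultimately show ?thesis by (metis norm_minus_cancel)
    qed
    then show ?thesis using B by blast
  qed
  have "(F \<longlongrightarrow> U - I) at_bot"
  proof (rule tendstoI)
    fix e :: real assume "e > 0"
    then obtain B where "\<And>a. a \<le> - B \<Longrightarrow> norm (F a - (U - I)) \<le> e / 2"
      using bot'[of "e / 2"] by auto
    then show "eventually (\<lambda>t. dist (F t) (U - I) < e) at_bot"
      using \<open>e > 0\<close> unfolding eventually_at_bot_linorder dist_norm
      by (intro exI[of _ "- B"]) force
  qed
  \<comment> \<open>So far \<open>U\<close> is a limit along integers only. The joint estimate with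
    one left endpoint \<open>a\<close> far out extends it to all real times.\<close>
  moreover have "(F \<longlongrightarrow> U) at_top"
  proof (rule tendstoI)
    fix e :: real assume "e > 0"
    then obtain B B' where B: "\<And>a b. a \<le> - B \<Longrightarrow> B \<le> b \<Longrightarrow> norm (F b - F a - I) < e / 2"
      and B': "\<And>a. a \<le> - B' \<Longrightarrow> norm (F a - (U - I)) \<le> e / 2"
      using *[of "e / 2"] bot'[of "e / 2"] by auto
    define a where "a = min (- B) (- B')"
    have "norm (F b - U) < e" if "b \<ge> B" for b
    proof -
      have "norm (F b - F a - I) < e / 2" "norm (F a - (U - I)) \<le> e / 2"
        using B[OF _ that, of a] B'[of a] by (simp_all add: a_def)
      then have "norm ((F b - F a - I) + (F a - (U - I))) < e"
        using norm_triangle_ineq[of "F b - F a - I" "F a - (U - I)"] by simp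
      then show ?thesis by simp
    qed
    then show "eventually (\<lambda>t. dist (F t) U < e) at_top"
      unfolding eventually_at_top_linorder dist_norm by blast
  qed
  ultimately show thesis using that by simp
qed

text \<open>An antiderivative of \<open>v\<close> can be written linearly in \<open>v\<close> and a
  primitive of \<open>f\<close>, both of which converge at both ends of the line.\<close>

lemma lti_has_integral:
  fixes v f :: "real \<Rightarrow> complex^'n"
  assumes v': "\<And>t. (v has_vector_derivative N *v v t + f t) (at t)"
    and N: "\<And>l u. eigenpair N l u \<Longrightarrow> Re l \<noteq> 0"
    and bdd_nth: "\<And>t i. norm (v t $ i) \<le> K"
    and f: "(f has_integral I) UNIV"
  shows "\<exists>J. (v has_integral J) UNIV \<and> N *v J + I = 0"
proof -
  have bdd: "norm (v t) \<le> (\<Sum>i\<in>(UNIV::'n set). K)" for t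
    unfolding norm_vec_def by (rule order_trans[OF L2_set_le_sum sum_mono[OF bdd_nth]]) simp
  have "isCont v t" for t using v' has_vector_derivative_continuous by blast
  then obtain V where V: "\<And>t. (V has_vector_derivative v t) (at t)"
    using einterval_antiderivative[of "- \<infinity>" \<infinity> v] by auto
  \<comment> \<open>A primitive of \<open>f\<close> that asks no regularity of \<open>f\<close>: the
    equation itself exhibits \<open>f\<close> as a derivative.\<close>
  define F where "F t = v t - N *v V t" for t
  have F': "(F has_vector_derivative f t) (at t)" for t
    using has_vector_derivative_diff[OF v' bounded_linear.has_vector_derivative[
        OF matrix_vector_mul_bounded_linear[of N] V], of t]
    by (simp add: F_def[abs_def])
  obtain U L where UL: "(F \<longlongrightarrow> U) at_top" "(F \<longlongrightarrow> L) at_bot" "U - L = I"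
    using has_integral_UNIV_primitiveE[OF F' f] .
  have top: "(v \<longlongrightarrow> 0) at_top"
    by (rule lti_lim_primitive[OF v' N bdd F' UL(1)])
  have refl: "((\<lambda>t. g (- t)) has_vector_derivative - g') (at t)"
    if "(g has_vector_derivative g') (at (- t))" for g :: "real \<Rightarrow> complex^'n" and g' t
  proof -
    have "(uminus has_vector_derivative (- 1 :: real)) (at t)"
      by (auto intro!: derivative_eq_intros)
    from vector_diff_chain_at[OF this that] show ?thesis by (simp add: o_def)
  qed
  \<comment> \<open>Time reversal replaces \<open>N\<close> by \<open>- N\<close>; the spectral
    hypothesis is symmetric under this change of sign.\<close>
  have "((\<lambda>t. v (- t)) \<longlongrightarrow> 0) at_top"
  proof (rule lti_lim_primitive[where N = "- N" and F = "\<lambda>t. F (- t)" and f = "\<lambda>t. - f (- t)"])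
    have "- (N *v w + z) = - N *v w + - z" for w z
      by (simp add: vec_eq_iff matrix_vector_mult_def sum_negf)
    then show "((\<lambda>t. v (- t)) has_vector_derivative - N *v v (- t) + - f (- t)) (at t)" for t
      using refl[OF v'] by metis
    show "((\<lambda>t. F (- t)) has_vector_derivative - f (- t)) (at t)" for t
      using refl[OF F'] .
    show "((\<lambda>t. F (- t)) \<longlongrightarrow> L) at_top"
      using UL(2) by (simp add: filterlim_at_bot_mirror)
    show "Re l \<noteq> 0" if "eigenpair (- N) l u" for l u
      using N[of "- l" u] that by (simp add: eigenpair_uminus)
  qed (rule bdd)
  then have bot: "(v \<longlongrightarrow> 0) at_bot" by (simp add: filterlim_at_bot_mirror)
  have "\<nexists>u. eigenpair N 0 u" using N by force
  then obtain B where B: "B ** (N - mat 0) = mat 1" by (rule not_eigenvalue_invertible)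
  then have BN: "B ** N = mat 1" by simp
  then have NB: "N ** B = mat 1" by (simp add: matrix_left_right_inverse)
  \<comment> \<open>Since \<open>v t - F t\<close> is \<open>N *v V t\<close>, this function is
    \<open>V\<close>; the new form lets its limits be read off.\<close>
  have "((\<lambda>t. B *v (v t - F t)) has_vector_derivative v t) (at t)" for t
    using bounded_linear.has_vector_derivative[OF matrix_vector_mul_bounded_linear[of B]
        has_vector_derivative_diff[OF v' F'], of t]
    by (simp add: matrix_vector_mul_assoc BN)
  moreover have "((\<lambda>t. B *v (v t - F t)) \<longlongrightarrow> B *v (0 - U)) at_top"
    "((\<lambda>t. B *v (v t - F t)) \<longlongrightarrow> B *v (0 - L)) at_bot"
    by (intro bounded_linear.tendsto[OF matrix_vector_mul_bounded_linear] tendsto_diff top bot UL)+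
  ultimately have "(v has_integral B *v (0 - U) - B *v (0 - L)) UNIV"
    by (rule has_integral_UNIV_primitive)
  also have "B *v (0 - U) - B *v (0 - L) = B *v (- I)"
    by (simp add: UL(3)[symmetric] flip: matrix_vector_mult_diff_distrib)
  finally have "(v has_integral B *v (- I)) UNIV" .
  moreover have "N *v (B *v (- I)) + I = 0" by (simp add: matrix_vector_mul_assoc NB)
  ultimately show ?thesis by blast
qed

section \<open>Coordinatewise calculus for complex vectors\<close>

lemma bounded_linear_axis: "bounded_linear (axis i :: complex \<Rightarrow> complex^'n)"
  unfolding linear_conv_bounded_linear[symmetric]
  by (rule linearI) (auto simp: axis_def vec_eq_iff)

lemma sum_axis: "(\<Sum>i\<in>UNIV. axis i (v $ i)) = (v :: complex^'n)"
  by (simp add: vec_eq_iff axis_def)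

lemma has_vector_derivative_vecI:
  fixes f :: "real \<Rightarrow> complex^'n"
  assumes "\<And>i. ((\<lambda>t. f t $ i) has_vector_derivative f' $ i) (at t)"
  shows "(f has_vector_derivative f') (at t)"
proof -
  have "((\<lambda>t. \<Sum>i\<in>UNIV. axis i (f t $ i)) has_vector_derivative (\<Sum>i\<in>UNIV. axis i (f' $ i))) (at t)"
    by (intro has_vector_derivative_sum bounded_linear.has_vector_derivative[OF bounded_linear_axis] assms)
  then show ?thesis by (simp add: sum_axis)
qed

lemma has_integral_vecI:
  fixes f :: "real \<Rightarrow> complex^'n"
  assumes "\<And>i. ((\<lambda>t. f t $ i) has_integral I $ i) S"
  shows "(f has_integral I) S"
proof -
  have "((\<lambda>t. \<Sum>i\<in>UNIV. axis i (f t $ i)) has_integral (\<Sum>i\<in>UNIV. axis i (I $ i))) S"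
    using has_integral_linear[OF assms bounded_linear_axis]
    by (intro has_integral_sum) (auto simp: o_def)
  then show ?thesis by (simp add: sum_axis)
qed

section \<open>Square-integrable random variables\<close>

lemma square_integrable_mult:
  fixes f g :: "'a \<Rightarrow> real"
  assumes "f \<in> borel_measurable M" "g \<in> borel_measurable M"
    and "integrable M (\<lambda>x. (f x)\<^sup>2)" "integrable M (\<lambda>x. (g x)\<^sup>2)"
  shows "integrable M (\<lambda>x. f x * g x)"
proof (rule Bochner_Integration.integrable_bound[of M "\<lambda>x. (f x)\<^sup>2 + (g x)\<^sup>2"])
  show "AE x in M. norm (f x * g x) \<le> norm ((f x)\<^sup>2 + (g x)\<^sup>2)"
  proof (rule AE_I2)
    fix x
    have "\<bar>f x\<bar> * \<bar>g x\<bar> \<le> (f x)\<^sup>2 + (g x)\<^sup>2"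
      using sum_squares_bound[of "\<bar>f x\<bar>" "\<bar>g x\<bar>"] mult_nonneg_nonneg[OF abs_ge_zero abs_ge_zero, of "f x" "g x"]
      by (simp only: power2_abs)
    then show "norm (f x * g x) \<le> norm ((f x)\<^sup>2 + (g x)\<^sup>2)" by (simp add: abs_mult)
  qed
qed (use assms in auto)

text \<open>Plain functions rather than classes modulo null sets: closure under linear combinations
  and integrability of products are all that is asked of this set.\<close>

definition L2 :: "'a measure \<Rightarrow> ('a \<Rightarrow> real) set" where
  "L2 M = {f \<in> borel_measurable M. integrable M (\<lambda>x. (f x)\<^sup>2)}"

lemma L2_mult: "f \<in> L2 M \<Longrightarrow> g \<in> L2 M \<Longrightarrow> integrable M (\<lambda>x. f x * g x)"
  by (auto simp: L2_def square_integrable_mult)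

lemma L2_cmult: "f \<in> L2 M \<Longrightarrow> (\<lambda>x. c * f x) \<in> L2 M"
  by (auto simp: L2_def power_mult_distrib)

lemma L2_add: "f \<in> L2 M \<Longrightarrow> g \<in> L2 M \<Longrightarrow> (\<lambda>x. f x + g x) \<in> L2 M"
  using L2_mult[of f M g] by (auto simp: L2_def power2_sum mult.assoc)

lemma L2_diff: "f \<in> L2 M \<Longrightarrow> g \<in> L2 M \<Longrightarrow> (\<lambda>x. f x - g x) \<in> L2 M"
  using L2_add[OF _ L2_cmult[of g M "-1"], of f] by simp

lemma L2_sum: "(\<And>i. i \<in> I \<Longrightarrow> f i \<in> L2 M) \<Longrightarrow> (\<lambda>x. \<Sum>i\<in>I. f i x) \<in> L2 M"
proof (induction I rule: infinite_finite_induct)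
  case (insert i I)
  then show ?case by (simp add: L2_add)
qed (auto simp: L2_def)

text \<open>A weighted Young inequality, obtained by expanding a square. Weight 1 later bounds the
  correlations; an adjustable weight gives the continuity of the pairing.\<close>

lemma L2_abs_integral_mult_le:
  assumes f: "f \<in> L2 M" and g: "g \<in> L2 M" and "\<epsilon> > 0"
  shows "2 * \<bar>LINT x|M. f x * g x\<bar> \<le> (LINT x|M. (f x)\<^sup>2) / \<epsilon> + \<epsilon> * (LINT x|M. (g x)\<^sup>2)"
proof -
  have *: "2 * \<bar>f x * g x\<bar> \<le> (f x)\<^sup>2 / \<epsilon> + \<epsilon> * (g x)\<^sup>2" for x
  proof -
    have "0 \<le> (\<bar>f x\<bar> / sqrt \<epsilon> - sqrt \<epsilon> * \<bar>g x\<bar>)\<^sup>2" by simp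
    also have "\<dots> = (f x)\<^sup>2 / \<epsilon> + \<epsilon> * (g x)\<^sup>2 - 2 * \<bar>f x * g x\<bar>"
      using \<open>\<epsilon> > 0\<close> by (simp add: power2_diff power_divide power_mult_distrib abs_mult)
    finally show ?thesis by simp
  qed
  have "2 * \<bar>LINT x|M. f x * g x\<bar> \<le> 2 * (LINT x|M. \<bar>f x * g x\<bar>)"
    using integral_norm_bound[of M "\<lambda>x. f x * g x"] by simp
  also have "\<dots> = (LINT x|M. 2 * \<bar>f x * g x\<bar>)" by simp
  also have "\<dots> \<le> (LINT x|M. (f x)\<^sup>2 / \<epsilon> + \<epsilon> * (g x)\<^sup>2)"
    using f g L2_mult[OF f g] * by (intro integral_mono) (auto simp: L2_def)
  also have "\<dots> = (LINT x|M. (f x)\<^sup>2) / \<epsilon> + \<epsilon> * (LINT x|M. (g x)\<^sup>2)"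
    using f g by (subst Bochner_Integration.integral_add) (auto simp: L2_def)
  finally show ?thesis .
qed

lemma wss_L2: "wss P X \<Longrightarrow> X t \<in> L2 P"
  by (simp add: wss_def L2_def)

lemma wss_power: "wss P X \<Longrightarrow> (LINT \<xi>|P. (X t \<xi>)\<^sup>2) = (LINT \<xi>|P. (X 0 \<xi>)\<^sup>2)"
proof -
  assume "wss P X"
  then have "(LINT \<xi>|P. X t \<xi> * X (t - 0) \<xi>) = (LINT \<xi>|P. X 0 \<xi> * X (0 - 0) \<xi>)"
    unfolding wss_def by blast
  then show ?thesis by (simp add: power2_eq_square)
qed

lemma tendsto_integral_mult_L2:
  assumes f: "eventually (\<lambda>h. f h \<in> L2 M) F" and Z: "Z \<in> L2 M"
    and lim: "((\<lambda>h. LINT x|M. (f h x)\<^sup>2) \<longlongrightarrow> 0) F"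
  shows "((\<lambda>h. LINT x|M. f h x * Z x) \<longlongrightarrow> 0) F"
proof (rule tendstoI)
  fix e :: real assume "e > 0"
  \<comment> \<open>The summand 1 keeps \<open>K\<close> positive when \<open>Z\<close> vanishes
    almost everywhere, so that \<open>e / K\<close> is a legitimate weight.\<close>
  define K where "K = (LINT x|M. (Z x)\<^sup>2) + 1"
  have K: "K > 0" "(LINT x|M. (Z x)\<^sup>2) < K" unfolding K_def by (auto intro: add_nonneg_pos)
  define \<epsilon> where "\<epsilon> = e / K"
  have \<epsilon>: "\<epsilon> > 0" using \<open>e > 0\<close> K by (simp add: \<epsilon>_def)
  have "eventually (\<lambda>h. (LINT x|M. (f h x)\<^sup>2) < e * \<epsilon>) F"
    using order_tendstoD(2)[OF lim] \<open>e > 0\<close> \<epsilon> by simp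
  with f show "eventually (\<lambda>h. dist (LINT x|M. f h x * Z x) 0 < e) F"
  proof eventually_elim
    case (elim h)
    have "2 * \<bar>LINT x|M. f h x * Z x\<bar> \<le> (LINT x|M. (f h x)\<^sup>2) / \<epsilon> + \<epsilon> * (LINT x|M. (Z x)\<^sup>2)"
      by (rule L2_abs_integral_mult_le[OF elim(1) Z \<epsilon>])
    also have "\<dots> < e + e"
    proof (rule add_less_le_mono)
      show "(LINT x|M. (f h x)\<^sup>2) / \<epsilon> < e" using elim(2) \<epsilon> by (simp add: pos_divide_less_eq)
      have "\<epsilon> * (LINT x|M. (Z x)\<^sup>2) \<le> \<epsilon> * K" using K \<epsilon> by simp
      also have "\<dots> = e" using K by (simp add: \<epsilon>_def)
      finally show "\<epsilon> * (LINT x|M. (Z x)\<^sup>2) \<le> e" .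
    qed
    finally show ?case by simp
  qed
qed

text \<open>The mean-square error of the difference quotient controls its pairing with any fixed
  square-integrable \<open>Z\<close>, so the derivative passes under the expectation.\<close>

lemma ms_derivative_correlation:
  fixes X :: "real \<Rightarrow> 'a \<Rightarrow> real^'k"
  assumes "has_ms_derivative P X D t"
    and X: "\<And>q s. coord X q s \<in> L2 P"
    and D: "\<And>q. (\<lambda>\<xi>. D \<xi> $ q) \<in> L2 P" and Z: "Z \<in> L2 P"
  shows "((\<lambda>s. LINT \<xi>|P. X s \<xi> $ p * Z \<xi>) has_real_derivative (LINT \<xi>|P. D \<xi> $ p * Z \<xi>)) (at t)"
proof -
  define \<Delta> where "\<Delta> h q \<xi> = (X (t + h) \<xi> $ q - X t \<xi> $ q) / h - D \<xi> $ q" for h q \<xi>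
  have \<Delta>: "\<Delta> h q \<in> L2 P" for h q
    unfolding \<Delta>_def using L2_cmult[OF L2_diff[OF X[of "t + h" q] X[of t q]], of "inverse h"]
    by (intro L2_diff D) (simp add: divide_inverse mult.commute)
  have norm_eq: "(norm ((X (t + h) \<xi> - X t \<xi>) /\<^sub>R h - D \<xi>))\<^sup>2 = (\<Sum>q\<in>UNIV. (\<Delta> h q \<xi>)\<^sup>2)" for h \<xi>
    unfolding norm_vec_def L2_set_def \<Delta>_def
    by (subst real_sqrt_pow2) (auto intro: sum_nonneg simp: divide_inverse mult.commute)
  \<comment> \<open>Square integrability enters here: a divergent integral would have value 0, and
    the comparison with the norm could fail.\<close>
  have le: "(LINT \<xi>|P. (\<Delta> h p \<xi>)\<^sup>2) \<le> (LINT \<xi>|P. (\<Sum>q\<in>UNIV. (\<Delta> h q \<xi>)\<^sup>2))" for h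
    using \<Delta> by (intro integral_mono) (auto simp: L2_def intro!: member_le_sum)
  have "((\<lambda>h. LINT \<xi>|P. (\<Delta> h p \<xi>)\<^sup>2) \<longlongrightarrow> 0) (at 0)"
    using assms(1) unfolding has_ms_derivative_def norm_eq
    by (rule tendsto_sandwich[OF _ _ tendsto_const, rotated 2]) (auto intro!: always_eventually le)
  then have "((\<lambda>h. LINT \<xi>|P. \<Delta> h p \<xi> * Z \<xi>) \<longlongrightarrow> 0) (at 0)"
    by (intro tendsto_integral_mult_L2[OF _ Z]) (auto intro: always_eventually \<Delta>)
  moreover have "(LINT \<xi>|P. \<Delta> h p \<xi> * Z \<xi>) =
      ((LINT \<xi>|P. X (t + h) \<xi> $ p * Z \<xi>) - (LINT \<xi>|P. X t \<xi> $ p * Z \<xi>)) / h - (LINT \<xi>|P. D \<xi> $ p * Z \<xi>)" for h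
    using L2_mult[OF X Z] L2_mult[OF D Z]
    by (simp add: \<Delta>_def left_diff_distrib diff_divide_distrib)
  ultimately show ?thesis
    by (simp add: DERIV_def LIM_zero_iff)
qed

section \<open>Networks of identical nodes\<close>

lemma matrix_inv_eqI:
  fixes S B :: "'a::field^'n^'n"
  assumes "S ** B = mat 1"
  shows "matrix_inv S = B"
proof -
  have "\<exists>A. S ** A = mat 1 \<and> A ** S = mat 1"
    using assms matrix_left_right_inverse by blast
  then have "matrix_inv S ** S = mat 1"
    unfolding matrix_inv_def by (rule someI2_ex) simp
  then show ?thesis
    using assms by (metis matrix_mul_assoc matrix_mul_lid matrix_mul_rid)
qed

lemma scalar_product_smult_right: "scalar_product u (a *s w) = a * scalar_product (u :: 'a::comm_semiring_1^'n) w"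
  by (simp add: scalar_product_def sum_distrib_left algebra_simps)

text \<open>The inverse of \<open>S\<close> turns out to be \<open>E' ** mat \<mu> ** E\<close>,
  where \<open>E\<close> scales \<open>u\<close> from the left and \<open>E'\<close> scales pairings
  with \<open>u\<close>. The scalar \<open>h'\<close> will be the conjugate of \<open>h\<close>; of
  this relation only the common vanishing enters.\<close>

lemma eigenvector_inverse_quadratic_form:
  fixes S W G :: "complex^'m^'m"
  assumes S: "S = mat h ** (W + G ** S)"
    and W: "W = mat h' ** (mat \<kappa> + W ** transpose G)"
    and inv: "invertible S" and \<kappa>: "\<kappa> \<noteq> 0"
    and hh': "h = 0 \<longleftrightarrow> h' = 0"
    and ev: "G *v u = l *s u" and u: "scalar_product u u = 1"
  shows "\<kappa> = (1 - h' * l) * (1 - h * l) / (scalar_product u (matrix_inv S *v u) * (h * h'))"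
proof -
  define E where "E = mat 1 - mat h ** G"
  define E' where "E' = mat 1 - mat h' ** transpose G"
  have Sij: "S $ i $ j = h * (W $ i $ j + (G ** S) $ i $ j)" for i j
    by (subst S) (simp add: mat_mul_eq)
  have Wij: "W $ i $ j = h' * (mat \<kappa> $ i $ j + (W ** transpose G) $ i $ j)" for i j
    by (subst W) (simp add: mat_mul_eq)
  obtain T where T: "S ** T = mat 1" using inv unfolding invertible_def by blast
  have h: "h \<noteq> 0"
  proof
    assume "h = 0"
    then have "S = 0" using Sij by (simp add: vec_eq_iff)
    then have "(mat 1 :: complex^'m^'m) = 0"
      using T by (simp add: vec_eq_iff matrix_matrix_mult_def)
    then have "(mat 1 :: complex^'m^'m) $ undefined $ undefined = 0" by simp
    then show False by (simp add: mat_def)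
  qed
  then have h': "h' \<noteq> 0" using hh' by simp
  have dl: "(A - B) ** C = A ** C - B ** C" and dr: "C ** (A - B) = C ** A - C ** B"
    for A B C :: "complex^'m^'m"
    by (simp_all add: vec_eq_iff matrix_matrix_mult_def sum_subtractf algebra_simps)
  have ES: "E ** S = mat h ** W"
  proof -
    have "(mat h ** G) ** S = mat h ** (G ** S)" by (simp add: matrix_mul_assoc)
    then show ?thesis
      unfolding E_def dl using Sij by (simp add: vec_eq_iff mat_mul_eq algebra_simps)
  qed
  have WE: "W ** E' = mat (h' * \<kappa>)"
  proof -
    have "W ** (mat h' ** transpose G) = mat h' ** (W ** transpose G)"
      by (metis mat_mul_commute matrix_mul_assoc)
    moreover have "mat (h' * \<kappa>) $ i $ j = h' * mat \<kappa> $ i $ j" for i j :: 'm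
      by (simp add: mat_def)
    ultimately show ?thesis
      unfolding E'_def dr using Wij by (simp add: vec_eq_iff mat_mul_eq algebra_simps)
  qed
  define \<mu> where "\<mu> = inverse (h * h' * \<kappa>)"
  have "h * h' * \<kappa> \<noteq> 0" using h h' \<kappa> by simp
  then have \<mu>: "h * h' * \<kappa> * \<mu> = 1" unfolding \<mu>_def by (rule right_inverse)
  have mm: "mat a ** mat b = (mat (a * b) :: complex^'m^'m)" for a b
    by (simp add: vec_eq_iff mat_mul_eq) (simp add: mat_def)
  have "E ** (S ** (E' ** mat \<mu>)) = (E ** S) ** E' ** mat \<mu>"
    by (simp add: matrix_mul_assoc)
  also have "\<dots> = mat h ** (W ** E') ** mat \<mu>"
    by (simp add: ES matrix_mul_assoc)
  also have "\<dots> = mat 1" using \<mu> by (simp add: WE mm mult.assoc)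
  finally have E_right: "E ** (S ** (E' ** mat \<mu>)) = mat 1" .
  \<comment> \<open>For square matrices one-sided inverses are two-sided. This moves
    \<open>E\<close> to the far right, so that \<open>S\<close> stands first.\<close>
  then have E_left: "(S ** (E' ** mat \<mu>)) ** E = mat 1"
    by (simp add: matrix_left_right_inverse)
  then have "S ** (E' ** mat \<mu> ** E) = mat 1"
    by (simp add: matrix_mul_assoc)
  then have invS: "matrix_inv S = E' ** mat \<mu> ** E" by (rule matrix_inv_eqI)
  have Eu: "E *v u = (1 - h * l) *s u"
    by (simp add: E_def matrix_vector_mult_diff_rdistrib mat_vec_eq ev
        vector_sub_rdistrib flip: matrix_vector_mul_assoc)
  have E'u: "scalar_product u (E' *v w) = (1 - h' * l) * scalar_product u w" for w
  proof -
    have "scalar_product u (transpose G *v w) = (\<Sum>i\<in>UNIV. \<Sum>k\<in>UNIV. G $ k $ i * u $ i * w $ k)"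
      by (simp add: scalar_product_def matrix_vector_mult_def transpose_def sum_distrib_left algebra_simps)
    also have "\<dots> = (\<Sum>k\<in>UNIV. (G *v u) $ k * w $ k)"
      by (subst sum.swap) (simp add: matrix_vector_mult_def sum_distrib_right)
    also have "\<dots> = l * scalar_product u w"
      by (simp add: ev scalar_product_def sum_distrib_left mult.assoc)
    finally have *: "scalar_product u (transpose G *v w) = l * scalar_product u w" .
    have "scalar_product u (E' *v w) = scalar_product u w - h' * scalar_product u (transpose G *v w)"
      by (simp add: E'_def matrix_vector_mult_diff_rdistrib mat_vec_eq flip: matrix_vector_mul_assoc)
         (simp add: scalar_product_def sum_subtractf sum_distrib_left algebra_simps)
    then show ?thesis unfolding * by (simp add: algebra_simps)
  qed
  \<comment> \<open>Both scalars must be nonzero before dividing by the quadratic form. If one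
    vanished, \<open>E\<close> would annihilate \<open>u\<close>, or the range of \<open>E'\<close>
    would be orthogonal to \<open>u\<close>, although both matrices are invertible.\<close>
  have "1 - h * l \<noteq> 0"
  proof
    assume "1 - h * l = 0"
    then have "E *v u = 0" using Eu by simp
    then have "u = 0" using E_left
      by (metis matrix_vector_mul_assoc matrix_vector_mul_lid matrix_vector_mult_0_right)
    then show False using u by (simp add: scalar_product_def)
  qed
  moreover have "1 - h' * l \<noteq> 0"
  proof
    assume 0: "1 - h' * l = 0"
    have "(E ** S) ** (E' ** mat \<mu>) = mat 1" using E_right by (simp add: matrix_mul_assoc)
    then have "(E' ** mat \<mu>) ** (E ** S) = mat 1" by (simp add: matrix_left_right_inverse)
    then have "E' *v (mat \<mu> *v ((E ** S) *v u)) = u"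
      by (metis matrix_vector_mul_assoc matrix_vector_mul_lid)
    then have "scalar_product u u = 0" using E'u 0 by (metis mult_zero_left)
    then show False using u by simp
  qed
  moreover have sp: "scalar_product u (matrix_inv S *v u) = (1 - h' * l) * (\<mu> * (1 - h * l))"
  proof -
    have "matrix_inv S *v u = E' *v (mat \<mu> *v (E *v u))"
      by (simp only: invS matrix_vector_mul_assoc matrix_mul_assoc)
    then show ?thesis by (simp only: E'u mat_vec_eq scalar_product_smult_right Eu u) simp
  qed
  moreover have "\<kappa> * (scalar_product u (matrix_inv S *v u) * (h * h')) = (1 - h' * l) * (1 - h * l)"
    using sp \<mu> by algebra
  ultimately show ?thesis by (metis mult_eq_0_iff mult_zero_right nonzero_eq_divide_eq)
qed

lemma sum_UNIV_prod: "(\<Sum>q\<in>UNIV. f q) = (\<Sum>i\<in>UNIV. \<Sum>k\<in>UNIV. f (i, k))"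
  for f :: "'a::finite \<times> 'b::finite \<Rightarrow> 'c::comm_monoid_add"
  by (simp add: sum.cartesian_product case_prod_unfold flip: UNIV_Times_UNIV)

lemma outer_nth: "outer b c $ k $ l = b $ k * c $ l"
  by (simp add: outer_def matrix_matrix_mult_def columnvector_def rowvector_def)

lemma network_matrix_nth:
  "(kron (mat 1) A + kron G (outer b c)) $ (i, k) $ (j, l) =
    (if i = j then A $ k $ l else 0) + G $ i $ j * (b $ k * c $ l)"
  by (simp add: kron_def outer_nth mat_def)

text \<open>Block \<open>i\<close> of the network equation says that \<open>mat s - cmat A\<close>
  maps that block of \<open>z\<close> to a multiple of \<open>cvec b\<close>, the factor being the
  drive \<open>g $ i\<close> plus the weighted outputs of the other blocks and of its own. As
  \<open>z\<close> and \<open>g\<close> are arbitrary, the lemma serves the state spectra as well as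
  the conjugated input-state spectra.\<close>

lemma nodal_response:
  fixes A :: "real^'n^'n" and G :: "real^'m^'m" and z :: "complex^('m \<times> 'n)" and g :: "complex^'m"
  assumes inv: "invertible (mat s - cmat A)"
    and eq: "\<And>p. s * z $ p = (\<Sum>q\<in>UNIV. (kron (mat 1) A + kron G (outer b c)) $ p $ q * z $ q)
      + b $ snd p * g $ fst p"
  shows "(\<Sum>k\<in>UNIV. c $ k * z $ (i, k)) =
    nodal_tf A b c s * (g $ i + (\<Sum>j\<in>UNIV. G $ i $ j * (\<Sum>k\<in>UNIV. c $ k * z $ (j, k))))"
proof -
  define y where "y j = (\<Sum>k\<in>UNIV. c $ k * z $ (j, k))" for j
  define \<alpha> where "\<alpha> = g $ i + (\<Sum>j\<in>UNIV. G $ i $ j * y j)"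
  define zi where "zi = (\<chi> k. z $ (i, k))"
  have "s * z $ (i, k) = (\<Sum>l\<in>UNIV. A $ k $ l * z $ (i, l)) + b $ k * \<alpha>" for k
  proof -
    have "s * z $ (i, k) = (\<Sum>j\<in>UNIV. \<Sum>l\<in>UNIV.
        complex_of_real ((if i = j then A $ k $ l else 0) + G $ i $ j * (b $ k * c $ l)) * z $ (j, l))
        + b $ k * g $ i"
      unfolding eq sum_UNIV_prod network_matrix_nth by simp
    also have "\<dots> = (\<Sum>j\<in>UNIV. \<Sum>l\<in>UNIV. complex_of_real (if i = j then A $ k $ l else 0) * z $ (j, l))
        + (\<Sum>j\<in>UNIV. b $ k * (G $ i $ j * y j)) + b $ k * g $ i"
      by (simp add: y_def sum_distrib_left algebra_simps sum.distrib)
    also have "(\<Sum>j\<in>UNIV. \<Sum>l\<in>UNIV. complex_of_real (if i = j then A $ k $ l else 0) * z $ (j, l))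
        = (\<Sum>j\<in>UNIV. if i = j then \<Sum>l\<in>UNIV. A $ k $ l * z $ (i, l) else 0)"
      by (rule sum.cong) auto
    also have "\<dots> = (\<Sum>l\<in>UNIV. A $ k $ l * z $ (i, l))" by simp
    finally show ?thesis
      by (simp add: \<alpha>_def sum_distrib_left algebra_simps)
  qed
  then have "(mat s - cmat A) *v zi = \<alpha> *s cvec b"
    by (simp add: vec_eq_iff matrix_vector_mult_diff_rdistrib mat_vec_eq zi_def)
       (simp add: matrix_vector_mult_def algebra_simps)
  moreover have "matrix_inv (mat s - cmat A) ** (mat s - cmat A) = mat 1"
    using inv unfolding invertible_def matrix_inv_def by (rule someI2_ex) simp
  ultimately have "zi = matrix_inv (mat s - cmat A) *v (\<alpha> *s cvec b)"
    by (metis matrix_vector_mul_assoc matrix_vector_mul_lid)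
  then have "zi = \<alpha> *s (matrix_inv (mat s - cmat A) *v cvec b)"
    by (simp add: vec_eq_iff matrix_vector_mult_def sum_distrib_left mult_ac)
  then have "scalar_product (cvec c) zi = \<alpha> * nodal_tf A b c s"
    by (simp add: nodal_tf_def scalar_product_smult_right)
  then show ?thesis
    by (simp add: scalar_product_def zi_def \<alpha>_def y_def mult.commute)
qed

theorem lemma5:
  fixes P :: "'a measure"
    and A :: "real^'n^'n" and b c :: "real^'n" and G :: "real^'m^'m"
    and x :: "real \<Rightarrow> 'a \<Rightarrow> real^('m \<times> 'n)"
    and w y :: "real \<Rightarrow> 'a \<Rightarrow> real^'m"
    and S_w :: "real \<Rightarrow> real" and \<Omega> \<omega> :: real
    and l :: complex and u :: "complex^'m"
  assumes "prob_space P"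
    and "\<And>i j. G $ i $ j \<ge> 0"
    and "hurwitz (kron (mat 1) A + kron G (outer b c))"
    and state_eq: "\<And>t. has_ms_derivative P x
          (\<lambda>\<xi>. (kron (mat 1) A + kron G (outer b c)) *v x t \<xi> + kron_col (mat 1) b *v w t \<xi>) t"
    and output_eq: "\<And>t \<xi>. y t \<xi> = kron_row (mat 1) c *v x t \<xi>"
    and steady_state: "\<And>p q. jointly_wss P (coord x p) (coord x q)"
    and "\<And>i. wss P (coord w i)"
    and "\<And>i t. (LINT \<xi>|P. w t \<xi> $ i) = 0"
    and "\<And>i j. i \<noteq> j \<Longrightarrow> uncorrelated P (coord w i) (coord w j)"
    and "\<And>i j \<tau>. cross_corr P (coord w i) (coord w i) \<tau> = cross_corr P (coord w j) (coord w j) \<tau>"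
    and input_psd: "\<And>i \<omega>'. psd P (coord w i) \<omega>' = complex_of_real (S_w \<omega>')"
    and "\<Omega> > 0"
    and "\<And>\<omega>'. \<omega>' \<in> {-\<Omega><..<\<Omega>} \<Longrightarrow> S_w \<omega>' > 0"
    and "eigenpair (cmat G) l u" and normalized: "scalar_product u u = 1"
    and "\<omega> \<in> {-\<Omega><..<\<Omega>}"
    and h_defined: "invertible (mat (\<i> * of_real \<omega>) - cmat A)"
    and S_invertible: "invertible (cross_psd_matrix P y \<omega>)"
  shows "complex_of_real (S_w \<omega>) =
    (let h = nodal_tf A b c (\<i> * of_real \<omega>) in
      (l\<^sup>2 * of_real ((cmod h)\<^sup>2) - 2 * l * of_real (Re h) + 1) /
      (scalar_product u (matrix_inv (cross_psd_matrix P y \<omega>) *v u) * of_real ((cmod h)\<^sup>2)))"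
proof -
  define M where "M = kron (mat 1) A + kron G (outer b c)"
  define s where "s = \<i> * complex_of_real \<omega>"
  define e where "e \<tau> = exp (- (\<i> * complex_of_real (\<omega> * \<tau>)))" for \<tau>
  have norm_e: "norm (e \<tau>) = 1" for \<tau> by (simp add: e_def)
  have e': "(e has_vector_derivative - s * e \<tau>) (at \<tau>)" for \<tau>
    unfolding e_def s_def of_real_mult
    by (rule has_vector_derivative_real_field[of "\<lambda>z. exp (- (\<i> * (of_real \<omega> * z)))"])
       (auto intro!: derivative_eq_intros)
  have wss_x: "wss P (coord x p)" for p using steady_state[of p p] by (simp add: jointly_wss_def)
  note wss_w = assms(7)
  note x_L2 = wss_L2[OF wss_x] and w_L2 = wss_L2[OF wss_w]

  \<comment> \<open>Differentiation of correlations with the state\<close>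
  have D_nth: "((kron (mat 1) A + kron G (outer b c)) *v x t \<xi> + kron_col (mat 1) b *v w t \<xi>) $ p
      = (\<Sum>q\<in>UNIV. M $ p $ q * x t \<xi> $ q) + b $ snd p * w t \<xi> $ fst p" for t \<xi> p
    by (simp add: M_def matrix_vector_mult_def kron_col_def mat_def if_distrib[where f = "\<lambda>x. x * _"]
        mult.assoc sum.delta cong: if_cong)
  have D_L2: "(\<lambda>\<xi>. (\<Sum>q\<in>UNIV. M $ p $ q * x t \<xi> $ q) + b $ snd p * w t \<xi> $ fst p) \<in> L2 P" for t p
    by (intro L2_add L2_sum L2_cmult x_L2 w_L2)
  have dx: "((\<lambda>t. LINT \<xi>|P. x t \<xi> $ p * Z \<xi>) has_real_derivative
      (\<Sum>q\<in>UNIV. M $ p $ q * (LINT \<xi>|P. x t \<xi> $ q * Z \<xi>)) + b $ snd p * (LINT \<xi>|P. w t \<xi> $ fst p * Z \<xi>)) (at t)"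
    if Z: "Z \<in> L2 P" for Z p t
  proof -
    have "((\<lambda>t. LINT \<xi>|P. x t \<xi> $ p * Z \<xi>) has_real_derivative
        (LINT \<xi>|P. ((\<Sum>q\<in>UNIV. M $ p $ q * x t \<xi> $ q) + b $ snd p * w t \<xi> $ fst p) * Z \<xi>)) (at t)"
      using ms_derivative_correlation[OF state_eq _ _ Z, of t p] x_L2 D_L2 by (simp only: D_nth)
    also have "(LINT \<xi>|P. ((\<Sum>q\<in>UNIV. M $ p $ q * x t \<xi> $ q) + b $ snd p * w t \<xi> $ fst p) * Z \<xi>)
       = (LINT \<xi>|P. (\<Sum>q\<in>UNIV. M $ p $ q * (x t \<xi> $ q * Z \<xi>)) + b $ snd p * (w t \<xi> $ fst p * Z \<xi>))"
      by (simp add: distrib_right sum_distrib_right mult.assoc)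
    also have "\<dots> = (\<Sum>q\<in>UNIV. M $ p $ q * (LINT \<xi>|P. x t \<xi> $ q * Z \<xi>))
        + b $ snd p * (LINT \<xi>|P. w t \<xi> $ fst p * Z \<xi>)"
      by (simp add: L2_mult[OF x_L2 Z] L2_mult[OF w_L2 Z])
    finally show ?thesis .
  qed

  \<comment> \<open>Differential equations of the correlations\<close>
  define R where "R p q \<tau> = (LINT \<xi>|P. x 0 \<xi> $ p * x (- \<tau>) \<xi> $ q)" for p q \<tau>
  define Q where "Q i q \<tau> = (LINT \<xi>|P. w 0 \<xi> $ i * x (- \<tau>) \<xi> $ q)" for i q \<tau>
  define r where "r = cross_corr P (coord w undefined) (coord w undefined)"
  have R: "(LINT \<xi>|P. x t \<xi> $ p * x (t - \<tau>) \<xi> $ q) = R p q \<tau>" for t p q \<tau>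
  proof -
    have "(LINT \<xi>|P. x t \<xi> $ p * x (t - \<tau>) \<xi> $ q) = (LINT \<xi>|P. x 0 \<xi> $ p * x (0 - \<tau>) \<xi> $ q)"
      using steady_state[of p q] unfolding jointly_wss_def by blast
    then show ?thesis by (simp add: R_def)
  qed
  have w_corr: "(LINT \<xi>|P. w (- \<tau>) \<xi> $ j * w 0 \<xi> $ i) = (if j = i then r \<tau> else 0)" for i j \<tau>
  proof (cases "j = i")
    case True
    have "cross_corr P (coord w i) (coord w i) \<tau> = r \<tau>" unfolding r_def by (rule assms(10))
    then show ?thesis using True by (simp add: cross_corr_def mult.commute)
  next
    case False
    then show ?thesis
      using assms(9)[of j i] assms(8) by (simp add: uncorrelated_def)
  qed
  \<comment> \<open>Both sides come out of the same derivative of \<open>R p q\<close>, which supplies the joint stationarity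
    of \<open>w\<close> and \<open>x\<close>.\<close>
  have bQ: "b $ snd p * (LINT \<xi>|P. w \<tau> \<xi> $ fst p * x 0 \<xi> $ q) = b $ snd p * Q (fst p) q \<tau>" for p q \<tau>
  proof -
    have 1: "(R p q has_real_derivative (\<Sum>s\<in>UNIV. M $ p $ s * R s q \<tau>)
        + b $ snd p * (LINT \<xi>|P. w \<tau> \<xi> $ fst p * x 0 \<xi> $ q)) (at \<tau>)"
    proof -
      have "(LINT \<xi>|P. x t \<xi> $ p' * x 0 \<xi> $ q) = R p' q t" for p' t
        using R[of t p' t q] by simp
      then show ?thesis using dx[OF x_L2[of 0 q], of p \<tau>] by simp
    qed
    \<comment> \<open>The second time is frozen at \<open>- \<tau>\<close> and the derivative taken
      at 0, so the input is sampled at time 0 as in \<open>Q\<close>; in \<open>1\<close> it was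
      sampled at \<tau>.\<close>
    have 2: "((\<lambda>t. R p q (t + \<tau>)) has_real_derivative (\<Sum>s\<in>UNIV. M $ p $ s * R s q \<tau>)
        + b $ snd p * Q (fst p) q \<tau>) (at 0)"
    proof -
      have "(LINT \<xi>|P. x t \<xi> $ p * x (- \<tau>) \<xi> $ q) = R p q (t + \<tau>)" for t
        using R[of t p "t + \<tau>" q] by simp
      then show ?thesis using dx[OF x_L2[of "- \<tau>" q], of p 0] by (simp add: R_def Q_def)
    qed
    have "(R p q has_real_derivative (\<Sum>s\<in>UNIV. M $ p $ s * R s q \<tau>)
        + b $ snd p * Q (fst p) q \<tau>) (at (0 + \<tau>))"
      using 2 by (subst DERIV_shift)
    with 1 have "(\<Sum>s\<in>UNIV. M $ p $ s * R s q \<tau>) + b $ snd p * (LINT \<xi>|P. w \<tau> \<xi> $ fst p * x 0 \<xi> $ q)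
      = (\<Sum>s\<in>UNIV. M $ p $ s * R s q \<tau>) + b $ snd p * Q (fst p) q \<tau>"
      using DERIV_unique by fastforce
    \<comment> \<open>The factor \<open>b $ snd p\<close> may be 0 and stays on both sides; in the
      equation for \<open>R\<close> it accompanies \<open>Q\<close> anyway.\<close>
    then show ?thesis by simp
  qed
  have dR: "(R p q has_real_derivative (\<Sum>s\<in>UNIV. M $ p $ s * R s q \<tau>) + b $ snd p * Q (fst p) q \<tau>) (at \<tau>)"
    for p q \<tau>
  proof -
    have "(LINT \<xi>|P. x t \<xi> $ p' * x 0 \<xi> $ q) = R p' q t" for p' t
      using R[of t p' t q] by simp
    then show ?thesis using dx[OF x_L2[of 0 q], of p \<tau>] by (simp add: bQ)
  qed
  \<comment> \<open>Time enters \<open>Q\<close> through the state, and with reversed sign; hence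
    the minus in front of the state equation.\<close>
  have dQ: "(Q i q has_real_derivative - ((\<Sum>s\<in>UNIV. M $ q $ s * Q i s \<tau>)
      + b $ snd q * (if fst q = i then r \<tau> else 0))) (at \<tau>)" for i q \<tau>
  proof -
    have Q_swap: "(LINT \<xi>|P. x (- \<tau>) \<xi> $ q * w 0 \<xi> $ i) = Q i q \<tau>" for q \<tau>
      by (simp add: Q_def mult.commute)
    have "((\<lambda>t. LINT \<xi>|P. x t \<xi> $ q * w 0 \<xi> $ i) has_real_derivative
        (\<Sum>s\<in>UNIV. M $ q $ s * Q i s \<tau>) + b $ snd q * (if fst q = i then r \<tau> else 0)) (at (- \<tau>))"
      using dx[OF w_L2[of 0 i], of q "- \<tau>"] unfolding w_corr Q_swap .
    then have "((\<lambda>\<tau>. LINT \<xi>|P. x (- \<tau>) \<xi> $ q * w 0 \<xi> $ i) has_real_derivative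
        - ((\<Sum>s\<in>UNIV. M $ q $ s * Q i s \<tau>) + b $ snd q * (if fst q = i then r \<tau> else 0))) (at \<tau>)"
      by (subst (asm) DERIV_mirror) simp
    then show ?thesis unfolding Q_swap .
  qed

  \<comment> \<open>Uniform bounds on the correlations\<close>
  have bound: "\<bar>LINT \<xi>|P. f \<xi> * g \<xi>\<bar> \<le> (LINT \<xi>|P. (f \<xi>)\<^sup>2) + (LINT \<xi>|P. (g \<xi>)\<^sup>2)"
    if "f \<in> L2 P" "g \<in> L2 P" for f g
    using L2_abs_integral_mult_le[OF that, of 1] by simp
  \<comment> \<open>One constant for both families: \<open>R\<close> uses the state power twice,
    \<open>Q\<close> the input power and the state power once.\<close>
  define K where "K = (\<Sum>p\<in>UNIV. LINT \<xi>|P. (x 0 \<xi> $ p)\<^sup>2) + (\<Sum>i\<in>UNIV. LINT \<xi>|P. (w 0 \<xi> $ i)\<^sup>2)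
     + (\<Sum>p\<in>UNIV. LINT \<xi>|P. (x 0 \<xi> $ p)\<^sup>2)"
  have x_le: "(LINT \<xi>|P. (x t \<xi> $ p)\<^sup>2) \<le> (\<Sum>p\<in>UNIV. LINT \<xi>|P. (x 0 \<xi> $ p)\<^sup>2)" for t p
    unfolding wss_power[OF wss_x, of t p] by (rule member_le_sum) auto
  have w_le: "(LINT \<xi>|P. (w t \<xi> $ p)\<^sup>2) \<le> (\<Sum>p\<in>UNIV. LINT \<xi>|P. (w 0 \<xi> $ p)\<^sup>2)" for t p
    unfolding wss_power[OF wss_w, of t p] by (rule member_le_sum) auto
  have nonneg: "(\<Sum>p\<in>UNIV. LINT \<xi>|P. (x 0 \<xi> $ p)\<^sup>2) \<ge> 0" "(\<Sum>i\<in>UNIV. LINT \<xi>|P. (w 0 \<xi> $ i)\<^sup>2) \<ge> 0"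
    by (auto intro: sum_nonneg)
  have R_bdd: "\<bar>R p q \<tau>\<bar> \<le> K" for p q \<tau>
    using bound[OF x_L2[of 0 p] x_L2[of "- \<tau>" q]] x_le[of 0 p] x_le[of "- \<tau>" q] nonneg
    unfolding R_def K_def by linarith
  have Q_bdd: "\<bar>Q i q \<tau>\<bar> \<le> K" for i q \<tau>
    using bound[OF w_L2[of 0 i] x_L2[of "- \<tau>" q]] w_le[of 0 i] x_le[of "- \<tau>" q] nonneg
    unfolding Q_def K_def by linarith

  \<comment> \<open>Fourier integrals of the correlations\<close>
  have M_eig: "Re k < 0" if "eigenpair (cmat M) k v" for k v
    using assms(3) that unfolding hurwitz_def M_def by blast
  \<comment> \<open>The Fourier kernel shifts the system matrix by \<open>- s\<close> and preserves
    boundedness, so a Fourier integral becomes the plain integral of a bounded solution.\<close>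
  have e_times: "((\<lambda>t. e t * complex_of_real (f t)) has_vector_derivative
      e t * (complex_of_real f' - s * complex_of_real (f t))) (at t)"
    if "(f has_real_derivative f') (at t)" for f f' t
  proof -
    have "((\<lambda>t. complex_of_real (f t)) has_vector_derivative complex_of_real f') (at t)"
      using that by (intro has_vector_derivative_of_real)
        (simp add: has_real_derivative_iff_has_vector_derivative)
    from has_vector_derivative_mult[OF e' this] show ?thesis
      by (simp add: algebra_simps)
  qed

  define \<kappa> where "\<kappa> = complex_of_real (S_w \<omega>)"
  have "S_w \<omega> > 0" using assms(13,16) by blast
  then have \<kappa>: "\<kappa> \<noteq> 0" "cnj \<kappa> = \<kappa>" by (auto simp: \<kappa>_def)
  \<comment> \<open>A divergent integral would have the default value 0; as the value is the nonzero
    \<kappa>, the integral converges.\<close>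
  have r_hat: "((\<lambda>\<tau>. e \<tau> * complex_of_real (r \<tau>)) has_integral \<kappa>) UNIV"
  proof -
    have "integral UNIV (\<lambda>\<tau>. e \<tau> * complex_of_real (r \<tau>)) = \<kappa>"
      using input_psd[of undefined \<omega>]
      by (simp add: cross_psd_def fourier_def e_def r_def \<kappa>_def mult.commute)
    then show ?thesis
      using \<kappa>(1) by (metis integrable_integral not_integrable_integral)
  qed

  have "\<forall>i. \<exists>J :: complex^('m \<times> 'n). \<forall>q. ((\<lambda>\<tau>. e \<tau> * complex_of_real (Q i q \<tau>)) has_integral J $ q) UNIV \<and>
      - s * J $ q = (\<Sum>p\<in>UNIV. M $ q $ p * J $ p) + b $ snd q * (if fst q = i then \<kappa> else 0)"
    (is "\<forall>i. ?E i")
  proof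
    fix i
    define v where "v \<tau> = (\<chi> q. e \<tau> * complex_of_real (Q i q \<tau>))" for \<tau>
    define f where "f \<tau> = (\<chi> q. - (b $ snd q * (if fst q = i then e \<tau> * complex_of_real (r \<tau>) else 0)))" for \<tau>
    define I where "I = (\<chi> q. - (b $ snd q * (if fst q = i then \<kappa> else 0)))"
    \<comment> \<open>With \<open>s\<close> imaginary and \<open>M\<close> Hurwitz, all eigenvalues
      of this matrix have positive real part.\<close>
    define N where "N = - cmat M - mat s"
    have Nv: "(N *v z) $ q = - (\<Sum>p\<in>UNIV. M $ q $ p * z $ p) - s * z $ q" for z q
      by (simp add: N_def matrix_vector_mult_diff_rdistrib mat_vec_eq)
         (simp add: matrix_vector_mult_def sum_negf)
    have "\<exists>J. (v has_integral J) UNIV \<and> N *v J + I = 0"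
    proof (rule lti_has_integral)
      show "(v has_vector_derivative N *v v \<tau> + f \<tau>) (at \<tau>)" for \<tau>
      proof (rule has_vector_derivative_vecI)
        fix q
        show "((\<lambda>t. v t $ q) has_vector_derivative (N *v v \<tau> + f \<tau>) $ q) (at \<tau>)"
          using e_times[OF dQ[of i q \<tau>]]
          by (auto simp: Nv v_def f_def sum_distrib_left algebra_simps)
      qed
      show "Re k \<noteq> 0" if "eigenpair N k z" for k z
      proof -
        have "(\<Sum>p\<in>UNIV. M $ q $ p * z $ p) = (- k - s) * z $ q" for q
        proof -
          have "- (\<Sum>p\<in>UNIV. M $ q $ p * z $ p) - s * z $ q = k * z $ q"
            using Nv[of z q] that by (simp add: eigenpair_def)
          then show ?thesis by algebra
        qed
        then have "eigenpair (cmat M) (- k - s) z"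
          using that unfolding eigenpair_def by (simp add: vec_eq_iff[of "_ *v _"])
            (simp add: matrix_vector_mult_def left_diff_distrib)
        from M_eig[OF this] show ?thesis by (simp add: s_def)
      qed
      show "norm (v t $ q) \<le> K" for t q
        using Q_bdd by (simp add: v_def norm_mult norm_e)
      show "(f has_integral I) UNIV"
      proof (rule has_integral_vecI)
        fix q
        show "((\<lambda>t. f t $ q) has_integral I $ q) UNIV"
          using has_integral_neg[OF has_integral_mult_right[OF r_hat, of "complex_of_real (b $ snd q)"]]
          by (auto simp: f_def I_def)
      qed
    qed
    then obtain J where J: "(v has_integral J) UNIV" "N *v J + I = 0" by blast
    have "((\<lambda>\<tau>. e \<tau> * complex_of_real (Q i q \<tau>)) has_integral J $ q) UNIV" for q
      using has_integral_linear[OF J(1) bounded_linear_vec_nth, of q] by (simp add: o_def v_def)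
    moreover have "- s * J $ q = (\<Sum>p\<in>UNIV. M $ q $ p * J $ p) + b $ snd q * (if fst q = i then \<kappa> else 0)" for q
    proof -
      have "(N *v J + I) $ q = 0" using J(2) by simp
      then show ?thesis
        unfolding vector_add_component Nv I_def vec_lambda_beta by algebra
    qed
    ultimately show "?E i" by blast
  qed
  from choice[OF this] obtain Qh :: "'m \<Rightarrow> complex^('m \<times> 'n)" where Qh_both:
    "\<forall>i q. ((\<lambda>\<tau>. e \<tau> * complex_of_real (Q i q \<tau>)) has_integral Qh i $ q) UNIV \<and>
      - s * Qh i $ q = (\<Sum>p\<in>UNIV. M $ q $ p * Qh i $ p) + b $ snd q * (if fst q = i then \<kappa> else 0)"
    by (elim exE) (rule that)
  note Qh = Qh_both[rule_format, THEN conjunct1] and Qh_eq = Qh_both[rule_format, THEN conjunct2]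

  \<comment> \<open>The forcing is now built from \<open>Q\<close>, whose integrals have just been
    shown to converge; this dictates the order of the two arguments.\<close>
  have "\<forall>q. \<exists>J :: complex^('m \<times> 'n). \<forall>p. ((\<lambda>\<tau>. e \<tau> * complex_of_real (R p q \<tau>)) has_integral J $ p) UNIV \<and>
      s * J $ p = (\<Sum>p'\<in>UNIV. M $ p $ p' * J $ p') + b $ snd p * Qh (fst p) $ q"
    (is "\<forall>q. ?E q")
  proof
    fix q
    define v where "v \<tau> = (\<chi> p. e \<tau> * complex_of_real (R p q \<tau>))" for \<tau>
    define f where "f \<tau> = (\<chi> p. b $ snd p * (e \<tau> * complex_of_real (Q (fst p) q \<tau>)))" for \<tau>
    define I where "I = (\<chi> p. b $ snd p * Qh (fst p) $ q)"
    define N where "N = cmat M - mat s"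
    have Nv: "(N *v z) $ q = (\<Sum>p\<in>UNIV. M $ q $ p * z $ p) - s * z $ q" for z q
      by (simp add: N_def matrix_vector_mult_diff_rdistrib mat_vec_eq)
         (simp add: matrix_vector_mult_def)
    have "\<exists>J. (v has_integral J) UNIV \<and> N *v J + I = 0"
    proof (rule lti_has_integral)
      show "(v has_vector_derivative N *v v \<tau> + f \<tau>) (at \<tau>)" for \<tau>
      proof (rule has_vector_derivative_vecI)
        fix p
        show "((\<lambda>t. v t $ p) has_vector_derivative (N *v v \<tau> + f \<tau>) $ p) (at \<tau>)"
          using e_times[OF dR[of p q \<tau>]]
          by (auto simp: Nv v_def f_def sum_distrib_left algebra_simps)
      qed
      show "Re k \<noteq> 0" if "eigenpair N k z" for k z
      proof -
        have "eigenpair (cmat M) (k + s) z"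
          using that unfolding eigenpair_def N_def
          by (auto simp: matrix_vector_mult_diff_rdistrib mat_vec_eq vec_eq_iff algebra_simps)
        from M_eig[OF this] show ?thesis by (simp add: s_def)
      qed
      show "norm (v t $ q) \<le> K" for t q
        using R_bdd by (simp add: v_def norm_mult norm_e)
      show "(f has_integral I) UNIV"
      proof (rule has_integral_vecI)
        fix p
        show "((\<lambda>t. f t $ p) has_integral I $ p) UNIV"
          using has_integral_mult_right[OF Qh, of "complex_of_real (b $ snd p)"]
          by (auto simp: f_def I_def)
      qed
    qed
    then obtain J where J: "(v has_integral J) UNIV" "N *v J + I = 0" by blast
    have "((\<lambda>\<tau>. e \<tau> * complex_of_real (R p q \<tau>)) has_integral J $ p) UNIV" for p
      using has_integral_linear[OF J(1) bounded_linear_vec_nth, of p] by (simp add: o_def v_def)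
    moreover have "s * J $ p = (\<Sum>p'\<in>UNIV. M $ p $ p' * J $ p') + b $ snd p * Qh (fst p) $ q" for p
    proof -
      have "(N *v J + I) $ p = 0" using J(2) by simp
      then show ?thesis
        unfolding vector_add_component Nv I_def vec_lambda_beta by algebra
    qed
    ultimately show "?E q" by blast
  qed
  from choice[OF this] obtain Rh :: "'m \<times> 'n \<Rightarrow> complex^('m \<times> 'n)" where Rh_both:
    "\<forall>q p. ((\<lambda>\<tau>. e \<tau> * complex_of_real (R p q \<tau>)) has_integral Rh q $ p) UNIV \<and>
      s * Rh q $ p = (\<Sum>p'\<in>UNIV. M $ p $ p' * Rh q $ p') + b $ snd p * Qh (fst p) $ q"
    by (elim exE) (rule that)
  note Rh = Rh_both[rule_format, THEN conjunct1] and Rh_eq = Rh_both[rule_format, THEN conjunct2]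

  \<comment> \<open>Algebraic relations between the spectra\<close>
  define S where "S = cross_psd_matrix P y \<omega>"
  define W :: "complex^'m^'m" where "W = (\<chi> i j. \<Sum>k\<in>UNIV. c $ k * Qh i $ (j, k))"
  define h where "h = nodal_tf A b c s"
  have y_nth: "y t \<xi> $ i = (\<Sum>k\<in>UNIV. c $ k * x t \<xi> $ (i, k))" for t \<xi> i
  proof -
    have "y t \<xi> $ i = (\<Sum>j\<in>UNIV. \<Sum>k\<in>UNIV. (if i = j then 1 else 0) * c $ k * x t \<xi> $ (j, k))"
      by (simp add: output_eq kron_row_def matrix_vector_mult_def mat_def sum_UNIV_prod)
    also have "\<dots> = (\<Sum>j\<in>UNIV. if i = j then \<Sum>k\<in>UNIV. c $ k * x t \<xi> $ (i, k) else 0)"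
      by (rule sum.cong) auto
    finally show ?thesis by simp
  qed
  have y_corr: "cross_corr P (coord y i) (coord y j) \<tau> =
      (\<Sum>k\<in>UNIV. \<Sum>l\<in>UNIV. c $ k * c $ l * R (i, k) (j, l) \<tau>)" for i j \<tau>
  proof -
    have "cross_corr P (coord y i) (coord y j) \<tau> =
       (LINT \<xi>|P. (\<Sum>k\<in>UNIV. \<Sum>l\<in>UNIV. c $ k * c $ l * (x 0 \<xi> $ (i, k) * x (- \<tau>) \<xi> $ (j, l))))"
      by (simp add: cross_corr_def y_nth sum_product mult_ac)
    also have "\<dots> = (\<Sum>k\<in>UNIV. \<Sum>l\<in>UNIV. c $ k * c $ l * R (i, k) (j, l) \<tau>)"
      by (simp add: R_def L2_mult[OF x_L2 x_L2])
    finally show ?thesis .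
  qed
  have S_nth: "S $ i $ j = (\<Sum>k\<in>UNIV. \<Sum>l\<in>UNIV. c $ k * c $ l * Rh (j, l) $ (i, k))" for i j
  proof -
    have "((\<lambda>\<tau>. \<Sum>k\<in>UNIV. \<Sum>l\<in>UNIV. complex_of_real (c $ k * c $ l) * (e \<tau> * complex_of_real (R (i, k) (j, l) \<tau>)))
        has_integral (\<Sum>k\<in>UNIV. \<Sum>l\<in>UNIV. complex_of_real (c $ k * c $ l) * Rh (j, l) $ (i, k))) UNIV"
      by (intro has_integral_sum has_integral_mult_right Rh) auto
    then show ?thesis
      by (simp add: S_def cross_psd_matrix_def cross_psd_def fourier_def y_corr e_def integral_unique
          sum_distrib_right sum_distrib_left mult_ac)
  qed
  have inv: "invertible (mat s - cmat A)" using h_defined by (simp add: s_def)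
  have S_eq: "S $ i $ j = h * (W $ i $ j + (\<Sum>k\<in>UNIV. G $ i $ k * S $ k $ j))" for i j
  proof -
    \<comment> \<open>The second state index is contracted with \<open>c\<close> here, the first one
      by \<open>nodal_response\<close>.\<close>
    define z where "z = (\<chi> p. \<Sum>l\<in>UNIV. c $ l * Rh (j, l) $ p)"
    define g where "g = (\<chi> i. W $ i $ j)"
    have z_out: "(\<Sum>k\<in>UNIV. c $ k * z $ (i, k)) = S $ i $ j" for i
      by (simp add: S_nth z_def sum_distrib_left mult_ac)
    have "s * z $ p = (\<Sum>q\<in>UNIV. (kron (mat 1) A + kron G (outer b c)) $ p $ q * z $ q)
      + b $ snd p * g $ fst p" for p
    proof -
      have "s * z $ p = (\<Sum>l\<in>UNIV. c $ l * (s * Rh (j, l) $ p))"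
        by (simp add: z_def sum_distrib_left mult_ac)
      also have "\<dots> = (\<Sum>l\<in>UNIV. \<Sum>q\<in>UNIV. M $ p $ q * (c $ l * Rh (j, l) $ q))
          + b $ snd p * g $ fst p"
        by (simp add: Rh_eq g_def W_def sum.distrib sum_distrib_left algebra_simps)
      also have "(\<Sum>l\<in>UNIV. \<Sum>q\<in>UNIV. M $ p $ q * (c $ l * Rh (j, l) $ q)) = (\<Sum>q\<in>UNIV. M $ p $ q * z $ q)"
        by (subst sum.swap) (simp add: z_def sum_distrib_left)
      finally show ?thesis by (simp only: M_def)
    qed
    from nodal_response[OF inv this, of i] show ?thesis
      by (simp only: z_out h_def) (simp add: g_def)
  qed
  \<comment> \<open>\<open>Qh\<close> solves the equation at \<open>- s\<close>. Conjugation turns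
    \<open>- s\<close> into \<open>s\<close> and fixes the real data and \<kappa>, so the same nodal
    response applies; conjugating back yields \<open>cnj h\<close>.\<close>
  have W_eq: "W $ i $ j = cnj h * ((if j = i then \<kappa> else 0) + (\<Sum>k\<in>UNIV. G $ j $ k * W $ i $ k))" for i j
  proof -
    define z where "z = (\<chi> q. cnj (Qh i $ q))"
    define g where "g = (\<chi> j. if j = i then \<kappa> else 0)"
    have z_out: "(\<Sum>k\<in>UNIV. c $ k * z $ (j, k)) = cnj (W $ i $ j)" for j
      by (simp add: W_def z_def)
    have "s * z $ p = (\<Sum>q\<in>UNIV. (kron (mat 1) A + kron G (outer b c)) $ p $ q * z $ q)
      + b $ snd p * g $ fst p" for p
    proof -
      have "s * z $ p = cnj (- s * Qh i $ p)" by (simp add: z_def s_def)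
      also have "\<dots> = (\<Sum>q\<in>UNIV. M $ p $ q * z $ q) + b $ snd p * g $ fst p"
        unfolding Qh_eq by (simp add: z_def g_def \<kappa>(2))
      finally show ?thesis by (simp only: M_def)
    qed
    from nodal_response[OF inv this, of j]
    have "cnj (W $ i $ j) = h * (g $ j + (\<Sum>k\<in>UNIV. G $ j $ k * cnj (W $ i $ k)))"
      by (simp only: z_out h_def)
    then have "cnj (cnj (W $ i $ j)) = cnj (h * (g $ j + (\<Sum>k\<in>UNIV. G $ j $ k * cnj (W $ i $ k))))"
      by (simp only:)
    then show ?thesis by (auto simp: g_def \<kappa>(2))
  qed

  \<comment> \<open>Evaluation of the quadratic form\<close>
  have "\<kappa> = (1 - cnj h * l) * (1 - h * l) / (scalar_product u (matrix_inv S *v u) * (h * cnj h))"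
  proof (rule eigenvector_inverse_quadratic_form)
    show "S = mat h ** (W + cmat G ** S)"
      unfolding vec_eq_iff mat_mul_eq
      by (intro allI, subst S_eq) (simp add: matrix_matrix_mult_def)
    show "W = mat (cnj h) ** (mat \<kappa> + W ** transpose (cmat G))"
      unfolding vec_eq_iff mat_mul_eq
      by (intro allI, subst W_eq)
         (simp add: matrix_matrix_mult_def transpose_def mat_def mult.commute eq_commute)
    show "invertible S" using S_invertible by (simp add: S_def)
    show "cmat G *v u = l *s u" using assms(14) by (simp add: eigenpair_def)
  qed (use \<kappa> normalized in auto)
  moreover have "(1 - cnj h * l) * (1 - h * l) = l\<^sup>2 * of_real ((cmod h)\<^sup>2) - 2 * l * of_real (Re h) + 1"
  proof -
    have "(1 - cnj h * l) * (1 - h * l) = l\<^sup>2 * (h * cnj h) - l * (h + cnj h) + 1"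
      by (simp add: power2_eq_square algebra_simps)
    then show ?thesis unfolding complex_norm_square complex_add_cnj by simp
  qed
  moreover have "h * cnj h = of_real ((cmod h)\<^sup>2)" by (rule complex_norm_square[symmetric])
  ultimately show ?thesis
    by (simp only: Let_def \<kappa>_def S_def h_def s_def)
qed

end
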